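(* Let $\mu>1$. For every integer $n>2$ and every $m\in\mathbb{Z}_+$, the function $\varphi^{(n,m)}$ is bell-shaped, i.e. $\varphi^{(n,m)}$ is centrally symmetric, is strictly increasing on $[0,|\mathrm{supp}\,\varphi^{(n,m)}|/2]$, and its second derivative has exactly 2 sign changes.
   Context: $\mathbb{Z}_+=\{0,1,2,\dots\}$; the Fourier transform is $\widehat f(\omega)=\int_{\mathbb{R}} f(x)e^{-i\omega x}\,dx$. Masks: fix a real parameter $\mu>1$. For an integer $n\ge 2$, let $a^{(n,0)}_0=a^{(n,0)}_1=\tfrac12$ and $a^{(n,0)}_\alpha=0$ otherwise; for $m\ge 1$ let $$a^{(n,m)}_\alpha=\frac{1}{2^{n+1+m^{-\mu}}}\left[\binom{n+1}{\alpha}+4\bigl(2^{m^{-\mu}}-1\bigr)\binom{n-1}{\alpha-1}\right],\quad 0\le\alpha\le n+1,$$ and $a^{(n,m)}_\alpha=0$ otherwise (with $\binom{p}{q}=0$ if $q<0$ or $q>p$). The symbols are $A^{(n,m)}(z)=\sum_\alpha a^{(n,m)}_\alpha z^\alpha$. Refinable functions: for $m\in\mathbb{Z}_+$, $\varphi^{(n,m)}\in L_2(\mathbb{R})$ is the compactly supported function with $\widehat{\varphi}^{(n,m)}(\omega)=\prod_{k=m}^{\infty}A^{(n,k)}\bigl(e^{-i\omega/2^{k+1}}\bigr)$. It belongs to $C^{n-1}(\mathbb{R})$ (continuous representative), and its support is $[0,\frac n2+1]$ for $m=0$ and $[0,2^{-m}(n+1)]$ for $m>0$; $|\mathrm{supp}\,\varphi^{(n,m)}|$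 denotes the length of this interval. Centrally symmetric means symmetric about the midpoint of the support: $\varphi^{(n,m)}(x)=\varphi^{(n,m)}(|\mathrm{supp}\,\varphi^{(n,m)}|-x)$. Sign changes are strict sign changes: the number of sign changes of a finite real sequence is counted after discarding zeros, and the number of sign changes of a function $f$ is the supremum over all $x_1<\dots<x_r$, $r\ge1$, of the number of sign changes of $(f(x_1),\dots,f(x_r))$. *)

theory Defs
  imports "HOL-Analysis.Analysis"
begin

text \<open>The case distinction at \<open>\<alpha> = 0\<close> is the convention that a binomial coefficient with
  negative lower index vanishes; subtraction on \<^typ>\<open>nat\<close> would give \<open>(n - 1) choose 0 = 1\<close>.\<close>

definition mask :: "real \<Rightarrow> nat \<Rightarrow> nat \<Rightarrow> nat \<Rightarrow> real" where
  "mask \<mu> n m \<alpha> =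
    (if m = 0 then (if \<alpha> \<le> 1 then 1 / 2 else 0)
     else if \<alpha> \<le> n + 1 then
       1 / 2 powr (real n + 1 + real m powr (- \<mu>)) *
         (real ((n + 1) choose \<alpha>) +
          4 * (2 powr (real m powr (- \<mu>)) - 1) *
            (if \<alpha> = 0 then 0 else real ((n - 1) choose (\<alpha> - 1))))
     else 0)"

definition mask_symbol :: "real \<Rightarrow> nat \<Rightarrow> nat \<Rightarrow> complex \<Rightarrow> complex" where
  "mask_symbol \<mu> n m z = (\<Sum>\<alpha>\<le>n + 1. complex_of_real (mask \<mu> n m \<alpha>) * z ^ \<alpha>)"

definition fourier :: "(real \<Rightarrow> real) \<Rightarrow> real \<Rightarrow> complex" where
  "fourier f \<omega> =
    integral\<^sup>L lborel (\<lambda>x. complex_of_real (f x) * exp (- \<i> * complex_of_real (\<omega> * x)))"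

definition supp :: "(real \<Rightarrow> real) \<Rightarrow> real set" where
  "supp f = closure {x. f x \<noteq> 0}"

text \<open>The infinite product over \<open>k \<ge> m\<close> is reindexed to start at \<open>0\<close>. Continuity picks the
  continuous representative of the class in \<open>L\<^sub>2\<close>.\<close>

definition is_refinable_function :: "real \<Rightarrow> nat \<Rightarrow> nat \<Rightarrow> (real \<Rightarrow> real) \<Rightarrow> bool" where
  "is_refinable_function \<mu> n m f \<longleftrightarrow>
    continuous_on UNIV f \<and>
    integrable lborel (\<lambda>x. (f x)\<^sup>2) \<and>
    compact (supp f) \<and>
    (\<forall>\<omega>. fourier f \<omega> =
       (\<Prod>k. mask_symbol \<mu> n (m + k) (exp (- \<i> * complex_of_real (\<omega> / 2 ^ (m + k + 1))))))"

definition refinable_function :: "real \<Rightarrow> nat \<Rightarrow> nat \<Rightarrow> real \<Rightarrow> real" where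
  "refinable_function \<mu> n m = (THE f. is_refinable_function \<mu> n m f)"

definition list_sign_changes :: "real list \<Rightarrow> nat" where
  "list_sign_changes xs =
    (let ys = filter (\<lambda>y. y \<noteq> 0) xs
     in card {i. Suc i < length ys \<and> ys ! i * ys ! Suc i < 0})"

definition sign_changes :: "(real \<Rightarrow> real) \<Rightarrow> enat" where
  "sign_changes f =
    (SUP xs \<in> {xs. xs \<noteq> [] \<and> sorted_wrt (<) xs}. enat (list_sign_changes (map f xs)))"

text \<open>Functions whose support is an interval starting at \<open>0\<close> are meant here, so that the
  Lebesgue measure of the support is the length of that interval and half of it is the
  midpoint.\<close>

definition supp_length :: "(real \<Rightarrow> real) \<Rightarrow> real" where
  "supp_length f = measure lborel (supp f)"

definition centrally_symmetric :: "(real \<Rightarrow> real) \<Rightarrow> bool" where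
  "centrally_symmetric f \<longleftrightarrow> (\<forall>x. f x = f (supp_length f - x))"

text \<open>The second derivative is given by derivative witnesses rather than by \<^const>\<open>deriv\<close>, whose
  value is unspecified where the derivative does not exist.\<close>

definition bell_shaped :: "(real \<Rightarrow> real) \<Rightarrow> bool" where
  "bell_shaped f \<longleftrightarrow>
    centrally_symmetric f \<and>
    strict_mono_on {0..supp_length f / 2} f \<and>
    (\<exists>f' f''. (\<forall>x. (f has_real_derivative f' x) (at x)) \<and>
              (\<forall>x. (f' has_real_derivative f'' x) (at x)) \<and>
              sign_changes f'' = 2)"

end

theory Submission
  imports Defs "HOL-Probability.Levy"
begin

text \<open>
  For \<open>m \<ge> 1\<close> the symbol factors as \<open>A_m(z) = ((1 + z) / 2)^(n - 1) B_m(z)\<close>, where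
  \<open>B_m(z) = p/4 + (1 - p/2) z + p/4 z^2\<close> with \<open>p = 2 powr (- (m powr (- \<mu>)))\<close> is close to
  \<open>((1 + z) / 2)^2\<close>, the symbol of the hat function.
  One factor \<open>(1 + z) / 2\<close> from each symbol, multiplied over all \<open>k \<ge> m\<close>, gives the Fourier transform of
  the moving average over a window of length \<open>2^(- m)\<close>. So \<open>\<phi>^(n,m)\<close> is the \<open>(n - 1)\<close>-fold
  moving average of the refinable function \<open>rough m\<close> that belongs to the symbols \<open>B_k\<close>.
  For \<open>m = 0\<close>, it is an \<open>(n - 1)\<close>-fold moving average of \<open>rough 1\<close>, in which one window has length \<open>1\<close>
  and the others have length \<open>1/2\<close>.

  \<^emph>\<open>Existence.\<close> The function \<open>rough m\<close> is the limit of the cascade that starts with the hat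
  function. One more step of the cascade at level \<open>k\<close> changes a function by at most \<open>k powr (- \<mu>)\<close> times
  a multiple of the hat function, because the coefficients of \<open>B_k\<close> differ from
  \<open>1/4, 1/2, 1/4\<close> by at most that factor. As \<open>\<mu> > 1\<close>, these errors are summable; the
  limit is continuous and lies between two positive multiples of the hat function
  (\<open>cascade_bounds\<close>, \<open>uniform_limit_cascade\<close>). Functions that are continuous and compactly supported are
  determined by their Fourier transforms (\<open>fourier_inj\<close>), so the moving averages are the
  functions of the theorem.

  \<^emph>\<open>At most two sign changes.\<close> Differentiating a moving average gives a difference of two
  translates. So the second derivative is a combination of translates of the \<open>(n - 3)\<close>-fold
  average of \<open>rough\<close>, and its coefficients are proportional to \<open>1, -2, 1\<close> (or \<open>1, -1, -1, 1\<close> if \<open>m = 0\<close>). Refining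
  replaces the coefficient polynomial \<open>V(z)\<close> by \<open>V(z^2) ((1 + z) / 2)^(n - 3) B_k(z)\<close>,
  which has no more sign changes than \<open>V\<close> (\<open>smooth_comb_refine\<close>). At a fine level the
  translated functions are nonnegative with tiny supports, so a sign of the sum at a
  point forces the same sign on a coefficient nearby, and the function has no more sign changes than the
  coefficients (\<open>comb_smooth_alternates\<close>).

  \<^emph>\<open>Monotonicity.\<close> The function \<open>rough m\<close> itself is in general not unimodal. But the derivative
  of its moving average is a difference of two translates, with at most one sign change;
  by symmetry that average increases up to its midpoint, and it does so strictly except possibly within
  half a window of the midpoint. Every further average is then strictly increasing up to its midpoint
  (\<open>unimodal_on_translate_less\<close>, \<open>unimodal_on_smooth\<close>).

  \<^emph>\<open>At least two sign changes.\<close> The first derivative vanishes at both ends of the support and at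
  its midpoint, is positive on the left half and negative on the right half; the mean value
  theorem gives the signs \<open>+, -, +\<close> of the second derivative.
\<close>

section \<open>Combinations of translates\<close>

text \<open>The combination of the translates of \<open>f\<close> by multiples of \<open>s\<close>, encoded by the polynomial of its
  coefficients. The point of the encoding is that composition of such operators is
  multiplication of polynomials, and that doubling the mesh \<open>s\<close> is the substitution of
  \<open>z^2\<close> for \<open>z\<close>; a refinement step is therefore a computation with polynomials.\<close>

definition comb :: "real poly \<Rightarrow> real \<Rightarrow> (real \<Rightarrow> real) \<Rightarrow> real \<Rightarrow> real" where
  "comb P s f x = (\<Sum>j\<le>degree P. coeff P j * f (x - real j * s))"

lemma comb_eq_sum:
  assumes "degree P \<le> N"
  shows "comb P s f x = (\<Sum>j\<le>N. coeff P j * f (x - real j * s))"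
  unfolding comb_def
  by (rule sum.mono_neutral_left) (use assms in \<open>auto simp: coeff_eq_0\<close>)

lemma comb_0 [simp]: "comb 0 s f x = 0"
  by (simp add: comb_def)

lemma comb_pCons [simp]: "comb (pCons a P) s f x = a * f x + comb P s f (x - s)"
proof -
  have "comb (pCons a P) s f x = (\<Sum>j\<le>Suc (degree P). coeff (pCons a P) j * f (x - real j * s))"
    by (rule comb_eq_sum) (simp add: degree_pCons_le)
  also have "\<dots> = a * f x + comb P s f (x - s)"
    by (subst sum.atMost_Suc_shift) (simp add: comb_def algebra_simps)
  finally show ?thesis .
qed

lemma comb_add: "comb (P + Q) s f x = comb P s f x + comb Q s f x"
proof -
  have "comb (P + Q) s f x = (\<Sum>j\<le>max (degree P) (degree Q). coeff (P + Q) j * f (x - real j * s))"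
    by (rule comb_eq_sum) (simp add: degree_add_le)
  then show ?thesis
    by (simp add: comb_eq_sum[of P "max (degree P) (degree Q)"]
        comb_eq_sum[of Q "max (degree P) (degree Q)"] sum.distrib algebra_simps)
qed

lemma comb_smult: "comb (smult c P) s f x = c * comb P s f x"
  by (subst comb_eq_sum[of _ "degree P"]) (auto simp: comb_def sum_distrib_left mult.assoc)

lemma comb_mult: "comb (P * Q) s f = comb P s (comb Q s f)"
proof (induction P)
  case 0
  show ?case by (simp add: fun_eq_iff)
next
  case (pCons a P)
  then show ?case by (simp add: fun_eq_iff comb_add comb_smult)
qed

lemma comb_upsample: "comb (P \<circ>\<^sub>p [:0, 0, 1:]) s f = comb P (2 * s) f"
proof (induction P)
  case 0
  show ?case by (simp add: fun_eq_iff)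
next
  case (pCons a P)
  then show ?case
    by (simp add: fun_eq_iff pcompose_pCons comb_add comb_smult algebra_simps)
qed

lemma comb_diff_fun: "comb P s (\<lambda>x. f x - g x) x = comb P s f x - comb P s g x"
  by (simp add: comb_def sum_subtractf algebra_simps)

lemma comb_scale_fun: "comb P s (\<lambda>x. c * f x) x = c * comb P s f x"
  by (simp add: comb_def sum_distrib_left algebra_simps)

lemma DERIV_translate:
  fixes f :: "real \<Rightarrow> real"
  assumes "\<And>x. (f has_real_derivative f' x) (at x)"
  shows "((\<lambda>x. f (x - c)) has_real_derivative f' (x - c)) (at x)"
  using DERIV_shift[of f "f' (x - c)" x "-c"] assms[of "x - c"] by simp

lemma DERIV_reflect:
  fixes f :: "real \<Rightarrow> real"
  assumes "\<And>x. (f has_real_derivative f' x) (at x)"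
  shows "((\<lambda>x. f (c - x)) has_real_derivative - f' (c - x)) (at x)"
proof -
  have "((\<lambda>x. c - x) has_real_derivative -1) (at x)"
    by (auto intro!: derivative_eq_intros)
  from DERIV_chain2[where f = f, OF assms this] show ?thesis by simp
qed

lemma DERIV_continuous_UNIV:
  fixes f :: "real \<Rightarrow> real"
  assumes "\<And>x. (f has_real_derivative f' x) (at x)"
  shows "continuous_on S f"
  using assms DERIV_isCont by (intro continuous_at_imp_continuous_on ballI) blast

lemma continuous_on_comb:
  assumes "continuous_on UNIV f"
  shows "continuous_on UNIV (comb P s f)"
  unfolding comb_def
  by (intro continuous_intros continuous_on_compose2[OF assms]) auto

lemma DERIV_comb:
  assumes "\<And>x. (f has_real_derivative f' x) (at x)"
  shows "(comb P s f has_real_derivative comb P s f' x) (at x)"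
  unfolding comb_def
  by (auto intro!: derivative_eq_intros DERIV_translate[OF assms] simp: mult.commute)

lemma tendsto_comb:
  assumes "\<And>x. (\<lambda>n. F n x) \<longlonglongrightarrow> f x"
  shows "(\<lambda>n. comb P s (F n) x) \<longlonglongrightarrow> comb P s f x"
  unfolding comb_def by (intro tendsto_intros assms)

section \<open>Averages over a sliding window\<close>

text \<open>The moving average. It turns a function that satisfies a refinement equation on a mesh of size
  \<open>s\<close> into one whose mask has an additional factor \<open>(1 + z) / 2\<close>; \<open>coarsen_double\<close> is the reason,
  since a window of length \<open>2 s\<close> is made of two windows of length \<open>s\<close>.\<close>

definition coarsen :: "real \<Rightarrow> (real \<Rightarrow> real) \<Rightarrow> real \<Rightarrow> real" where
  "coarsen s f x = integral {x - s..x} f / s"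

lemma continuous_has_antiderivative:
  fixes f :: "real \<Rightarrow> real"
  assumes "continuous_on UNIV f"
  obtains F where "\<And>x. (F has_real_derivative f x) (at x)"
proof -
  have "\<exists>F. \<forall>x::real. -\<infinity> < ereal x \<longrightarrow> ereal x < \<infinity> \<longrightarrow> (F has_vector_derivative f x) (at x)"
    by (rule einterval_antiderivative) (use assms in \<open>auto simp: continuous_on_eq_continuous_at\<close>)
  then show ?thesis
    using that by (auto simp: has_real_derivative_iff_has_vector_derivative)
qed

lemma integral_by_antiderivative:
  fixes f :: "real \<Rightarrow> real"
  assumes "\<And>x. (F has_real_derivative f x) (at x)" "a \<le> b"
  shows "integral {a..b} f = F b - F a"
  by (rule integral_unique, rule fundamental_theorem_of_calculus)
     (use assms in \<open>auto simp: has_real_derivative_iff_has_vector_derivative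
        intro: has_vector_derivative_at_within\<close>)

text \<open>With an antiderivative \<open>F\<close> the average is a difference quotient. The algebraic identities for
  averages below follow from this without any manipulation of integrals.\<close>

lemma coarsen_eq:
  assumes "\<And>x. (F has_real_derivative f x) (at x)" "s \<ge> 0"
  shows "coarsen s f x = (F x - F (x - s)) / s"
  unfolding coarsen_def using integral_by_antiderivative[OF assms(1), of "x - s" x] assms(2) by simp

lemma DERIV_coarsen:
  assumes "continuous_on UNIV f" "s \<ge> 0"
  shows "(coarsen s f has_real_derivative (f x - f (x - s)) / s) (at x)"
proof -
  obtain F where F: "\<And>x. (F has_real_derivative f x) (at x)"
    by (rule continuous_has_antiderivative[OF assms(1)]) blast
  have "((\<lambda>x. F (x - s)) has_real_derivative f (x - s)) (at x)"
    by (rule DERIV_translate[OF F])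
  then have "((\<lambda>x. (F x - F (x - s)) / s) has_real_derivative (f x - f (x - s)) / s) (at x)"
    using F[of x] by (intro DERIV_cdivide DERIV_diff)
  moreover have "coarsen s f = (\<lambda>x. (F x - F (x - s)) / s)"
    using coarsen_eq[OF F assms(2)] by auto
  ultimately show ?thesis by simp
qed

lemma continuous_on_coarsen:
  assumes "continuous_on UNIV f" "s \<ge> 0"
  shows "continuous_on UNIV (coarsen s f)"
  by (rule DERIV_continuous_UNIV[OF DERIV_coarsen[OF assms]])

lemma coarsen_comb:
  assumes "continuous_on UNIV f" "s \<ge> 0"
  shows "coarsen s (comb P t f) = comb P t (coarsen s f)"
proof
  fix x
  obtain F where F: "\<And>x. (F has_real_derivative f x) (at x)"
    by (rule continuous_has_antiderivative[OF assms(1)]) blast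
  have eq: "coarsen s f = (\<lambda>x. (F x - F (x - s)) / s)"
    using coarsen_eq[OF F assms(2)] by auto
  have "coarsen s (comb P t f) x = (comb P t F x - comb P t F (x - s)) / s"
    by (rule coarsen_eq[OF DERIV_comb[OF F] assms(2)])
  also have "comb P t F (x - s) = comb P t (\<lambda>x. F (x - s)) x"
    by (simp add: comb_def algebra_simps)
  also have "(comb P t F x - comb P t (\<lambda>x. F (x - s)) x) / s = comb P t (coarsen s f) x"
    unfolding eq using comb_scale_fun[of P t "1 / s" "\<lambda>x. F x - F (x - s)" x]
    by (simp add: comb_diff_fun)
  finally show "coarsen s (comb P t f) x = comb P t (coarsen s f) x" .
qed

lemma coarsen_double:
  assumes "continuous_on UNIV f" "s \<ge> 0"
  shows "coarsen (2 * s) f = comb [:1/2, 1/2:] s (coarsen s f)"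
proof
  fix x
  obtain F where F: "\<And>x. (F has_real_derivative f x) (at x)"
    by (rule continuous_has_antiderivative[OF assms(1)]) blast
  show "coarsen (2 * s) f x = comb [:1/2, 1/2:] s (coarsen s f) x"
  proof -
    have "(a - c) / (2 * s) = 1/2 * ((a - b) / s) + 1/2 * ((b - c) / s)" for a b c :: real
      by (cases "s = 0") (simp_all add: field_simps)
    from this[of "F x" "F (x - 2 * s)" "F (x - s)"] show ?thesis
      using assms(2) by (simp add: coarsen_eq[OF F])
  qed
qed

text \<open>The reflected function \<open>x \<mapsto> - F (L - x)\<close> is an antiderivative of \<open>f\<close> as well, and the average
  may be computed from either of the two.\<close>

lemma coarsen_symmetric:
  assumes "continuous_on UNIV f" "s \<ge> 0" "\<And>x. f (L - x) = f x"
  shows "coarsen s f (L + s - x) = coarsen s f x"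
proof -
  obtain F where F: "\<And>x. (F has_real_derivative f x) (at x)"
    by (rule continuous_has_antiderivative[OF assms(1)]) blast
  have "((\<lambda>x. - F (L - x)) has_real_derivative f x) (at x)" for x
    using DERIV_minus[OF DERIV_reflect[OF F, of L x]] assms(3) by simp
  then have "coarsen s f x = (- F (L - x) - - F (L - (x - s))) / s"
    by (rule coarsen_eq) (rule assms(2))
  moreover have "coarsen s f (L + s - x) = (F (L + s - x) - F (L + s - x - s)) / s"
    by (rule coarsen_eq[OF F assms(2)])
  moreover have "L - (x - s) = L + s - x" "L + s - x - s = L - x" by simp_all
  ultimately show ?thesis by simp
qed

section \<open>Symmetric bumps and their integrals\<close>

text \<open>The properties, apart from monotonicity, that all functions considered here share: the hat function,
  the limit of the cascade and their moving averages.\<close>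

definition bump_on :: "real \<Rightarrow> (real \<Rightarrow> real) \<Rightarrow> bool" where
  "bump_on L f \<longleftrightarrow> continuous_on UNIV f \<and> (\<forall>x. 0 < x \<and> x < L \<longrightarrow> f x > 0) \<and>
     (\<forall>x. x \<le> 0 \<or> L \<le> x \<longrightarrow> f x = 0) \<and> (\<forall>x. f (L - x) = f x)"

lemma bump_on_nonneg: "bump_on L f \<Longrightarrow> f x \<ge> 0"
  unfolding bump_on_def by (metis less_eq_real_def not_le)

text \<open>Every window \<open>{x - s..x}\<close> with \<open>0 < x < L + s\<close> meets \<open>{0<..<L}\<close> in a nontrivial interval, on which an
  antiderivative increases strictly.\<close>

lemma bump_on_coarsen:
  assumes "bump_on L f" "s > 0" "L > 0"
  shows "bump_on (L + s) (coarsen s f)"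
proof -
  have cont: "continuous_on UNIV f" and pos: "\<And>x. 0 < x \<Longrightarrow> x < L \<Longrightarrow> f x > 0"
    and zero: "\<And>x. x \<le> 0 \<or> L \<le> x \<Longrightarrow> f x = 0" and sym: "\<And>x. f (L - x) = f x"
    using assms(1) by (auto simp: bump_on_def)
  obtain F where F: "\<And>x. (F has_real_derivative f x) (at x)"
    by (rule continuous_has_antiderivative[OF cont]) blast
  have mono: "F a \<le> F b" if "a \<le> b" for a b
    by (rule DERIV_nonneg_imp_nondecreasing[OF that]) (use F bump_on_nonneg[OF assms(1)] in blast)
  have "coarsen s f x > 0" if "0 < x" "x < L + s" for x
  proof -
    \<comment> \<open>The part of the window where \<open>f\<close> is positive.\<close>
    define a b where "a = max 0 (x - s)" and "b = min L x"
    have ab: "a < b" "x - s \<le> a" "b \<le> x" using that assms by (auto simp: a_def b_def)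
    have "F a < F b"
    proof (rule DERIV_pos_imp_increasing_open[OF ab(1)])
      show "\<exists>y. (F has_real_derivative y) (at z) \<and> 0 < y" if "a < z" "z < b" for z
        using F[of z] pos[of z] that by (auto simp: a_def b_def)
      show "continuous_on {a..b} F"
        by (rule DERIV_continuous_UNIV[OF F])
    qed
    with mono[OF ab(2)] mono[OF ab(3)] have "F (x - s) < F x" by linarith
    then show ?thesis using assms by (simp add: coarsen_eq[OF F])
  qed
  moreover have "coarsen s f x = 0" if "x \<le> 0 \<or> L + s \<le> x" for x
  proof -
    have "integral {x - s..x} f = integral {x - s..x} (\<lambda>_. 0)"
      by (rule Henstock_Kurzweil_Integration.integral_cong) (use that zero in auto)
    then show ?thesis by (simp add: coarsen_def)
  qed
  moreover have "coarsen s f (L + s - x) = coarsen s f x" for x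
    by (rule coarsen_symmetric) (use cont assms sym in auto)
  ultimately show ?thesis
    using continuous_on_coarsen[OF cont] assms by (auto simp: bump_on_def)
qed

text \<open>Let \<open>F\<close> be the antiderivative of \<open>f\<close> that vanishes to the left of the support, and \<open>R\<close> an
  antiderivative of \<open>F\<close>. The integral of the average is a second difference of \<open>R\<close>, in
  which only the window \<open>{L..L + s}\<close> contributes, where \<open>F\<close> is constantly the integral of \<open>f\<close>.\<close>

lemma integral_coarsen:
  assumes cont: "continuous_on UNIV f" and zero: "\<And>x. x \<le> 0 \<or> L \<le> x \<Longrightarrow> f x = 0"
    and "s > 0" "L \<ge> 0"
  shows "integral {0..L + s} (coarsen s f) = integral {0..L} f"
proof -
  obtain F0 where F0: "\<And>x. (F0 has_real_derivative f x) (at x)"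
    by (rule continuous_has_antiderivative[OF cont]) blast
  \<comment> \<open>Normalized to vanish to the left of the support.\<close>
  define F where "F = (\<lambda>x. F0 x - F0 0)"
  have F: "(F has_real_derivative f x) (at x)" for x
    using DERIV_diff[OF F0[of x] DERIV_const[of "F0 0"]] by (simp add: F_def)
  have Fi: "F L = integral {0..L} f"
    using integral_by_antiderivative[OF F, of 0 L] assms by (simp add: F_def)
  have F_left: "F x = 0" if "x \<le> 0" for x
  proof -
    have "integral {x..0} f = integral {x..0} (\<lambda>_. 0)"
      by (rule Henstock_Kurzweil_Integration.integral_cong) (use that zero in auto)
    then show ?thesis using integral_by_antiderivative[OF F that] by (simp add: F_def)
  qed
  have F_right: "F x = F L" if "L \<le> x" for x
  proof -
    have "integral {L..x} f = integral {L..x} (\<lambda>_. 0)"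
      by (rule Henstock_Kurzweil_Integration.integral_cong) (use that zero in auto)
    then show ?thesis using integral_by_antiderivative[OF F that] by simp
  qed
  have "continuous_on UNIV F" by (rule DERIV_continuous_UNIV[OF F])
  then obtain R where R: "\<And>x. (R has_real_derivative F x) (at x)"
    using continuous_has_antiderivative by blast
  have Rs: "((\<lambda>x. R (x - s)) has_real_derivative F (x - s)) (at x)" for x
    by (rule DERIV_translate[OF R])
  have "((\<lambda>x. (R x - R (x - s)) / s) has_real_derivative coarsen s f x) (at x)" for x
    using DERIV_cdivide[OF DERIV_diff[OF R[of x] Rs[of x]], of s] coarsen_eq[OF F, of s x] assms(3) by simp
  from integral_by_antiderivative[OF this, of 0 "L + s"]
  have "integral {0..L + s} (coarsen s f) = (R (L + s) - R L) / s - (R 0 - R (0 - s)) / s"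
    using assms by simp
  also have "R (L + s) - R L = integral {L..L + s} F"
    using integral_by_antiderivative[OF R, of L "L + s"] assms by simp
  also have "\<dots> = integral {L..L + s} (\<lambda>_. F L)"
    by (rule Henstock_Kurzweil_Integration.integral_cong) (rule F_right, simp)
  also have "R 0 - R (0 - s) = integral {0 - s..0} F"
    using integral_by_antiderivative[OF R, of "0 - s" 0] assms by simp
  also have "\<dots> = integral {0 - s..0} (\<lambda>_. 0)"
    by (rule Henstock_Kurzweil_Integration.integral_cong) (use F_left in auto)
  finally show ?thesis using assms(3) Fi by simp
qed

lemma bump_on_supp:
  assumes "bump_on L f" "L > 0"
  shows "supp f = {0..L}" "supp_length f = L"
proof -
  have "{x. f x \<noteq> 0} = {0<..<L}"
    using assms(1) unfolding bump_on_def by (force simp: not_le)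
  then show "supp f = {0..L}" using assms(2) by (simp add: supp_def)
  then show "supp_length f = L" using assms(2) by (simp add: supp_length_def)
qed

lemma integrable_compactly_supported:
  fixes f :: "real \<Rightarrow> 'a :: euclidean_space"
  assumes "continuous_on UNIV f" "\<And>x. x \<notin> {a..b} \<Longrightarrow> f x = 0"
  shows "integrable lborel f"
proof -
  have "integrable lborel (\<lambda>x. indicator {a..b} x *\<^sub>R f x)"
    by (rule borel_integrable_compact) (auto intro: continuous_on_subset[OF assms(1)])
  also have "(\<lambda>x. indicator {a..b} x *\<^sub>R f x) = f"
    using assms(2) by (auto simp: indicator_def fun_eq_iff)
  finally show ?thesis .
qed

lemma lebesgue_integral_compactly_supported:
  fixes f :: "real \<Rightarrow> real"
  assumes "continuous_on UNIV f" "\<And>x. x \<notin> {a..b} \<Longrightarrow> f x = 0"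
  shows "integral\<^sup>L lborel f = integral {a..b} f"
proof -
  have f: "(\<lambda>x. indicator {a..b} x *\<^sub>R f x) = f"
    using assms(2) by (auto simp: indicator_def fun_eq_iff)
  have "set_integrable lborel {a..b} f"
    unfolding set_integrable_def f by (rule integrable_compactly_supported) fact+
  from set_borel_integral_eq_integral(2)[OF this] show ?thesis
    unfolding set_lebesgue_integral_def f .
qed

lemma bump_on_integrable: "bump_on L f \<Longrightarrow> integrable lborel f"
  by (rule integrable_compactly_supported[of _ 0 L]) (auto simp: bump_on_def)

lemma bump_on_lebesgue_integral: "bump_on L f \<Longrightarrow> integral\<^sup>L lborel f = integral {0..L} f"
  by (rule lebesgue_integral_compactly_supported) (auto simp: bump_on_def)

lemma bump_on_lebesgue_integral_coarsen:
  assumes "bump_on L f" "s > 0" "L > 0"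
  shows "integral\<^sup>L lborel (coarsen s f) = integral\<^sup>L lborel f"
  unfolding bump_on_lebesgue_integral[OF assms(1)] bump_on_lebesgue_integral[OF bump_on_coarsen[OF assms]]
  by (rule integral_coarsen) (use assms in \<open>auto simp: bump_on_def\<close>)

lemma integrable_translate:
  fixes f :: "real \<Rightarrow> 'a :: {banach, second_countable_topology}"
  assumes "integrable lborel f"
  shows "integrable lborel (\<lambda>x. f (x - c))"
  using lborel_integrable_real_affine[OF assms, of 1 "-c"] by simp

lemma lebesgue_integral_translate:
  fixes f :: "real \<Rightarrow> 'a :: {banach, second_countable_topology}"
  shows "integral\<^sup>L lborel (\<lambda>x. f (x - c)) = integral\<^sup>L lborel f"
  using lborel_integral_real_affine[of 1 f "-c"] by simp

lemma integrable_comb: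
  assumes "integrable lborel f"
  shows "integrable lborel (comb P s f)"
  unfolding comb_def by (intro Bochner_Integration.integrable_sum integrable_mult_right integrable_translate assms)

lemma lebesgue_integral_comb:
  assumes "integrable lborel f"
  shows "integral\<^sup>L lborel (comb P s f) = poly P 1 * integral\<^sup>L lborel f"
  unfolding comb_def
  by (subst Bochner_Integration.integral_sum)
     (auto simp: assms integrable_translate lebesgue_integral_translate poly_altdef sum_distrib_right)

section \<open>The hat function and perturbations of its mask\<close>

text \<open>The hat function on \<open>{0..2 * s}\<close>, normalized to have integral \<open>1\<close>: with this normalization the masks
  have coefficient sum \<open>1\<close>.\<close>

definition hat :: "real \<Rightarrow> real \<Rightarrow> real" where
  "hat s x = max 0 (s - \<bar>x - s\<bar>) / s\<^sup>2"

lemma bump_on_hat: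
  assumes "s > 0"
  shows "bump_on (2 * s) (hat s)"
proof -
  have "continuous_on UNIV (hat s)"
    unfolding hat_def using assms by (intro continuous_intros) auto
  moreover have "hat s x > 0" if "0 < x" "x < 2 * s" for x
    using that assms by (auto simp: hat_def max_def abs_if)
  moreover have "hat s x = 0" if "x \<le> 0 \<or> 2 * s \<le> x" for x
    using that assms by (auto simp: hat_def max_def abs_if)
  moreover have "hat s (2 * s - x) = hat s x" for x
    by (auto simp: hat_def abs_if)
  ultimately show ?thesis by (simp add: bump_on_def)
qed

lemma hat_refinement:
  assumes "s > 0"
  shows "hat (2 * s) = comb [:1/4, 1/2, 1/4:] s (hat s)"
proof
  fix x
  have "max 0 (2 * s - \<bar>x - 2 * s\<bar>) =
    max 0 (s - \<bar>x - s\<bar>) + 2 * max 0 (s - \<bar>x - s - s\<bar>) + max 0 (s - \<bar>x - s - s - s\<bar>)"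
    using assms by (auto simp: max_def abs_if)
  then show "hat (2 * s) x = comb [:1/4, 1/2, 1/4:] s (hat s) x"
    using assms by (simp add: hat_def field_simps power2_eq_square)
qed

lemma hat_le: "s > 0 \<Longrightarrow> hat s x \<le> 1 / s"
  by (auto simp: hat_def max_def abs_if field_simps power2_eq_square)

lemma integral_hat:
  assumes "s > 0"
  shows "integral\<^sup>L lborel (hat s) = 1"
proof -
  define c where "c = 1 / (2 * s\<^sup>2)"
  have c: "x / s\<^sup>2 = 2 * c * x" "c * s\<^sup>2 = 1 / 2" for x
    using assms by (simp_all add: c_def)
  have 1: "((\<lambda>x. x / s\<^sup>2) has_integral (c * s\<^sup>2 - c * 0\<^sup>2)) {0..s}"
    by (rule fundamental_theorem_of_calculus)
       (use assms in \<open>auto intro!: derivative_eq_intros simp: c(1)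
          simp flip: has_real_derivative_iff_has_vector_derivative\<close>)
  have 2: "((\<lambda>x. (2 * s - x) / s\<^sup>2) has_integral
      (- c * (2 * s - 2 * s)\<^sup>2 - - c * (2 * s - s)\<^sup>2)) {s..2 * s}"
    by (rule fundamental_theorem_of_calculus)
       (use assms in \<open>auto intro!: derivative_eq_intros simp: c(1) algebra_simps
          simp flip: has_real_derivative_iff_has_vector_derivative\<close>)
  have "(hat s has_integral 1/2) {0..s}"
    by (rule has_integral_eq[OF _ 1[THEN has_integral_eq_rhs]])
       (use assms c(2) in \<open>auto simp: hat_def max_def\<close>)
  moreover have "(hat s has_integral 1/2) {s..2 * s}"
    by (rule has_integral_eq[OF _ 2[THEN has_integral_eq_rhs]])
       (use assms c(2) in \<open>auto simp: hat_def max_def\<close>)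
  ultimately have "(hat s has_integral 1/2 + 1/2) {0..2 * s}"
    by (intro has_integral_combine[of 0 s]) (use assms in auto)
  then show ?thesis
    using bump_on_lebesgue_integral[OF bump_on_hat[OF assms]] by (simp add: integral_unique)
qed

text \<open>The symbol of the given masks, divided by the factors \<open>(1 + z) / 2\<close>. For \<open>e = 0\<close> it is
  \<open>((1 + z) / 2)^2\<close>, the mask of the hat function.\<close>

definition quad_mask :: "real \<Rightarrow> real poly" where
  "quad_mask e = [:2 powr (-e) / 4, 1 - 2 powr (-e) / 2, 2 powr (-e) / 4:]"

lemma quad_mask_at_1: "poly (quad_mask e) 1 = 1"
  by (simp add: quad_mask_def)

lemma powr_minus_bounds:
  assumes "e \<ge> 0"
  shows "0 < 2 powr (-e :: real)" "2 powr (-e :: real) \<le> 1" "1 - 2 powr (-e) \<le> e"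
    "2 - 2 powr (-e) \<le> 2 powr e"
proof -
  show "0 < 2 powr (-e)" by simp
  show le1: "2 powr (-e) \<le> 1" using assms powr_mono[of "-e" 0 2] by simp
  have "1 + (- e * ln 2) \<le> exp (- e * ln 2)" by (rule exp_ge_add_one_self)
  moreover have "e * ln 2 \<le> e * 1" by (rule mult_left_mono) (use assms ln_2_less_1 in auto)
  ultimately show "1 - 2 powr (-e) \<le> e" by (simp add: powr_def)
  have "2 powr e * 2 powr (-e) = 1" by (simp add: powr_add[symmetric])
  moreover have "0 \<le> 2 powr e * (1 - 2 powr (-e))\<^sup>2" by simp
  moreover have "2 powr e * (1 - 2 powr (-e))\<^sup>2
      = 2 powr e - 2 * (2 powr e * 2 powr (-e)) + 2 powr e * 2 powr (-e) * 2 powr (-e)"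
    by (simp add: power2_eq_square algebra_simps)
  ultimately show "2 - 2 powr (-e) \<le> 2 powr e" by simp
qed

lemma comb_quad_mono:
  assumes "e \<ge> 0" "\<And>x. f x \<le> g x"
  shows "comb (quad_mask e) s f x \<le> comb (quad_mask e) s g x"
proof -
  have "0 \<le> 2 powr (-e) / 4" "0 \<le> 1 - 2 powr (-e) / 2"
    using powr_minus_bounds[OF assms(1)] by auto
  then show ?thesis
    by (auto simp: quad_mask_def intro!: add_mono mult_left_mono assms(2))
qed

text \<open>The coefficients of the perturbed mask deviate from \<open>1/4, 1/2, 1/4\<close> by \<open>(1 - 2 powr (- e)) / 4\<close> times
  \<open>-1, 2, -1\<close>, which in absolute value is proportional to the unperturbed mask. So the
  perturbation is controlled \<^emph>\<open>relative\<close> to the unperturbed combination; this keeps the supports and the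
  positivity of the limit under control.\<close>

lemma comb_quad_bounds:
  assumes "e \<ge> 0" "\<And>x. f x \<ge> 0"
  shows "2 powr (-e) * comb [:1/4, 1/2, 1/4:] s f x \<le> comb (quad_mask e) s f x"
    "comb (quad_mask e) s f x \<le> 2 powr e * comb [:1/4, 1/2, 1/4:] s f x"
    "\<bar>comb (quad_mask e) s f x - comb [:1/4, 1/2, 1/4:] s f x\<bar> \<le> e * comb [:1/4, 1/2, 1/4:] s f x"
proof -
  define A B C where "A = f x" and "B = f (x - s)" and "C = f (x - s - s)"
  have nn: "A \<ge> 0" "B \<ge> 0" "C \<ge> 0" using assms(2) by (auto simp: A_def B_def C_def)
  define p where "p = 2 powr (-e)"
  note p = powr_minus_bounds[OF assms(1), folded p_def]
  have q: "comb (quad_mask e) s f x = p / 4 * A + (1 - p / 2) * B + p / 4 * C"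
    by (simp add: quad_mask_def p_def A_def B_def C_def)
  have h: "comb [:1/4, 1/2, 1/4:] s f x = 1 / 4 * A + 1 / 2 * B + 1 / 4 * C"
    by (simp add: A_def B_def C_def)
  have "p * (1 / 2) * B \<le> (1 - p / 2) * B" by (rule mult_right_mono) (use p nn in auto)
  then show "2 powr (-e) * comb [:1/4, 1/2, 1/4:] s f x \<le> comb (quad_mask e) s f x"
    unfolding q h p_def[symmetric] by (simp add: algebra_simps)
  have "p \<le> 2 powr e" using p(2) assms(1) ge_one_powr_ge_zero[of 2 e] by linarith
  then have "p / 4 * A \<le> 2 powr e * (1 / 4) * A" "p / 4 * C \<le> 2 powr e * (1 / 4) * C"
    by (intro mult_right_mono; use nn in simp)+
  moreover have "(1 - p / 2) * B \<le> 2 powr e * (1 / 2) * B"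
    by (rule mult_right_mono) (use p nn in auto)
  ultimately show "comb (quad_mask e) s f x \<le> 2 powr e * comb [:1/4, 1/2, 1/4:] s f x"
    unfolding q h by (simp add: algebra_simps)
  have "comb (quad_mask e) s f x - comb [:1/4, 1/2, 1/4:] s f x
      = (1 - p) * (1 / 2 * B - 1 / 4 * A - 1 / 4 * C)"
    unfolding q h by (simp add: field_simps)
  also have "\<bar>\<dots>\<bar> = (1 - p) * \<bar>1 / 2 * B - 1 / 4 * A - 1 / 4 * C\<bar>"
    using p by (simp add: abs_mult)
  also have "\<dots> \<le> e * (1 / 4 * A + 1 / 2 * B + 1 / 4 * C)"
    by (rule mult_mono) (use p nn assms(1) in auto)
  finally show "\<bar>comb (quad_mask e) s f x - comb [:1/4, 1/2, 1/4:] s f x\<bar>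
      \<le> e * comb [:1/4, 1/2, 1/4:] s f x" by (simp only: h)
qed

section \<open>Convergence of the perturbed cascade\<close>

abbreviation (input) mesh :: "nat \<Rightarrow> real" where
  "mesh m \<equiv> 1 / 2 ^ m"

text \<open>The masks enter through \<open>\<epsilon> k = k powr (- \<mu>)\<close>, which is summable because \<open>\<mu> > 1\<close>. Summability is what makes the
  cascade converge.\<close>

locale perturbed_cascade =
  fixes \<epsilon> :: "nat \<Rightarrow> real"
  assumes \<epsilon>_nonneg: "\<epsilon> k \<ge> 0" and \<epsilon>_summable: "summable \<epsilon>"
begin

text \<open>The functions of level \<open>m\<close> live on the mesh \<open>2^(- m)\<close>; \<^term>\<open>cascade m j\<close> uses the perturbed masks of
  the \<open>j\<close> levels from \<open>m\<close> on and the hat function below them.\<close>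

fun cascade :: "nat \<Rightarrow> nat \<Rightarrow> real \<Rightarrow> real" where
  "cascade m 0 = hat (mesh m)"
| "cascade m (Suc j) = comb (quad_mask (\<epsilon> m)) (mesh (Suc m)) (cascade (Suc m) j)"

lemma hat_mesh: "hat (mesh m) = comb [:1/4, 1/2, 1/4:] (mesh (Suc m)) (hat (mesh (Suc m)))"
  using hat_refinement[of "mesh (Suc m)"] by simp

lemma hat_mesh_nonneg: "hat (mesh m) x \<ge> 0"
  by (rule bump_on_nonneg[OF bump_on_hat]) simp

lemma cascade_bounds_partial:
  "2 powr (- sum \<epsilon> {m..<m + j}) * hat (mesh m) x \<le> cascade m j x \<and>
   cascade m j x \<le> 2 powr (sum \<epsilon> {m..<m + j}) * hat (mesh m) x"
proof (induction j arbitrary: m x)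
  case 0
  show ?case by simp
next
  case (Suc j)
  define S where "S = sum \<epsilon> {Suc m..<Suc m + j}"
  have S: "sum \<epsilon> {m..<m + Suc j} = \<epsilon> m + S"
    unfolding S_def by (subst sum.atLeast_Suc_lessThan) auto
  let ?h = "hat (mesh (Suc m))" and ?s = "mesh (Suc m)"
  have "2 powr (- (\<epsilon> m + S)) * hat (mesh m) x
      = 2 powr (-S) * (2 powr (- \<epsilon> m) * comb [:1/4, 1/2, 1/4:] ?s ?h x)"
  proof -
    have "- (\<epsilon> m + S) = - S + - \<epsilon> m" by simp
    then show ?thesis unfolding hat_mesh[of m] by (simp only: powr_add mult.assoc)
  qed
  also have "\<dots> \<le> 2 powr (-S) * comb (quad_mask (\<epsilon> m)) ?s ?h x"
    by (intro mult_left_mono comb_quad_bounds(1) \<epsilon>_nonneg hat_mesh_nonneg) auto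
  also have "\<dots> = comb (quad_mask (\<epsilon> m)) ?s (\<lambda>x. 2 powr (-S) * ?h x) x"
    by (simp add: comb_scale_fun)
  also have "\<dots> \<le> cascade m (Suc j) x"
    unfolding cascade.simps
    by (rule comb_quad_mono[OF \<epsilon>_nonneg]) (use Suc.IH[of "Suc m"] in \<open>simp add: S_def\<close>)
  finally have lower: "2 powr (- (\<epsilon> m + S)) * hat (mesh m) x \<le> cascade m (Suc j) x" .
  have "cascade m (Suc j) x \<le> comb (quad_mask (\<epsilon> m)) ?s (\<lambda>x. 2 powr S * ?h x) x"
    unfolding cascade.simps
    by (rule comb_quad_mono[OF \<epsilon>_nonneg]) (use Suc.IH[of "Suc m"] in \<open>simp add: S_def\<close>)
  also have "\<dots> = 2 powr S * comb (quad_mask (\<epsilon> m)) ?s ?h x"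
    by (simp add: comb_scale_fun)
  also have "\<dots> \<le> 2 powr S * (2 powr \<epsilon> m * comb [:1/4, 1/2, 1/4:] ?s ?h x)"
    by (intro mult_left_mono comb_quad_bounds(2) \<epsilon>_nonneg hat_mesh_nonneg) auto
  also have "\<dots> = 2 powr (\<epsilon> m + S) * hat (mesh m) x"
    unfolding hat_mesh[of m] by (simp add: powr_add mult.assoc mult.commute del: comb_pCons)
  finally show ?case unfolding S using lower by simp
qed

definition total :: real where "total = suminf \<epsilon>"

lemma sum_le_total: "sum \<epsilon> {m..<n} \<le> total"
  unfolding total_def by (rule sum_le_suminf) (use \<epsilon>_nonneg \<epsilon>_summable in auto)

lemma cascade_bounds:
  "2 powr (- total) * hat (mesh m) x \<le> cascade m j x"
  "cascade m j x \<le> 2 powr total * hat (mesh m) x"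
proof -
  have "2 powr (- total) * hat (mesh m) x \<le> 2 powr (- sum \<epsilon> {m..<m + j}) * hat (mesh m) x"
    by (rule mult_right_mono[OF _ hat_mesh_nonneg]) (simp add: sum_le_total)
  then show "2 powr (- total) * hat (mesh m) x \<le> cascade m j x"
    using cascade_bounds_partial[of m j x] by linarith
  have "2 powr (sum \<epsilon> {m..<m + j}) * hat (mesh m) x \<le> 2 powr total * hat (mesh m) x"
    by (rule mult_right_mono[OF _ hat_mesh_nonneg]) (simp add: sum_le_total)
  then show "cascade m j x \<le> 2 powr total * hat (mesh m) x"
    using cascade_bounds_partial[of m j x] by linarith
qed

text \<open>The estimate is inherited from the last level \<open>m + j\<close>, where the mask of the hat function is replaced
  by the perturbed one; each of the levels above it costs at most a factor \<open>2 powr \<epsilon> k\<close>.\<close>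

lemma cascade_increment_partial:
  "\<bar>cascade m (Suc j) x - cascade m j x\<bar>
    \<le> \<epsilon> (m + j) * 2 powr (sum \<epsilon> {m..<m + j}) * hat (mesh m) x"
proof (induction j arbitrary: m x)
  case 0
  have "\<bar>comb (quad_mask (\<epsilon> m)) (mesh (Suc m)) (hat (mesh (Suc m))) x - hat (mesh m) x\<bar>
      \<le> \<epsilon> m * hat (mesh m) x"
    unfolding hat_mesh[of m] by (rule comb_quad_bounds(3)[OF \<epsilon>_nonneg hat_mesh_nonneg])
  then show ?case by simp
next
  case (Suc j)
  define S where "S = sum \<epsilon> {Suc m..<Suc m + j}"
  have S: "sum \<epsilon> {m..<m + Suc j} = \<epsilon> m + S"
    unfolding S_def by (subst sum.atLeast_Suc_lessThan) auto
  let ?h = "hat (mesh (Suc m))" and ?s = "mesh (Suc m)" and ?Q = "quad_mask (\<epsilon> m)"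
  define C where "C = \<epsilon> (m + Suc j) * 2 powr S"
  have C: "C \<ge> 0" by (simp add: C_def \<epsilon>_nonneg)
  define D where "D x = cascade (Suc m) (Suc j) x - cascade (Suc m) j x" for x
  have D: "\<bar>D x\<bar> \<le> C * ?h x" for x
    using Suc.IH[of "Suc m" x] by (simp add: D_def C_def S_def del: cascade.simps)
  have "cascade m (Suc (Suc j)) x - cascade m (Suc j) x = comb ?Q ?s D x"
    unfolding cascade.simps(2)[of m] D_def comb_diff_fun ..
  moreover have "comb ?Q ?s D x \<le> comb ?Q ?s (\<lambda>x. C * ?h x) x"
    by (rule comb_quad_mono[OF \<epsilon>_nonneg]) (use D abs_le_D1 in blast)
  moreover have "comb ?Q ?s (\<lambda>x. - C * ?h x) x \<le> comb ?Q ?s D x"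
    by (rule comb_quad_mono[OF \<epsilon>_nonneg]) (use D in \<open>simp add: abs_le_iff minus_le_iff\<close>)
  ultimately have "\<bar>cascade m (Suc (Suc j)) x - cascade m (Suc j) x\<bar> \<le> C * comb ?Q ?s ?h x"
    unfolding comb_scale_fun by (simp add: abs_le_iff minus_le_iff)
  also have "\<dots> \<le> C * (2 powr \<epsilon> m * comb [:1/4, 1/2, 1/4:] ?s ?h x)"
    by (intro mult_left_mono comb_quad_bounds(2) \<epsilon>_nonneg hat_mesh_nonneg C)
  also have "\<dots> = \<epsilon> (m + Suc j) * 2 powr (\<epsilon> m + S) * hat (mesh m) x"
    unfolding hat_mesh[of m] C_def by (simp add: powr_add mult_ac del: comb_pCons)
  finally show ?case unfolding S .
qed

lemma cascade_increment: "\<bar>cascade m (Suc j) x - cascade m j x\<bar> \<le> \<epsilon> (m + j) * (2 powr total * 2 ^ m)"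
proof -
  have "\<bar>cascade m (Suc j) x - cascade m j x\<bar>
      \<le> \<epsilon> (m + j) * (2 powr (sum \<epsilon> {m..<m + j}) * hat (mesh m) x)"
    using cascade_increment_partial by (simp only: mult.assoc)
  also have "\<dots> \<le> \<epsilon> (m + j) * (2 powr total * 2 ^ m)"
    using hat_le[of "mesh m" x]
    by (intro mult_left_mono mult_mono \<epsilon>_nonneg hat_mesh_nonneg) (auto simp: sum_le_total)
  finally show ?thesis .
qed

text \<open>The refinable function for the masks without factors \<open>(1 + z) / 2\<close>. It is continuous, but in
  general not unimodal: for \<open>\<epsilon> k > 0\<close>, each refinement pulls the coefficients of even index below the
  mean of their two neighbours.\<close>

definition rough :: "nat \<Rightarrow> real \<Rightarrow> real" where
  "rough m x = lim (\<lambda>j. cascade m j x)"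

lemma uniform_limit_cascade: "uniform_limit UNIV (cascade m) (rough m) sequentially"
proof -
  have "summable (\<lambda>j. \<epsilon> (m + j) * (2 powr total * 2 ^ m))"
    using summable_ignore_initial_segment[OF \<epsilon>_summable, of m]
    by (intro summable_mult2) (simp add: add.commute)
  then have "uniform_limit UNIV (\<lambda>n x. \<Sum>j<n. cascade m (Suc j) x - cascade m j x)
      (\<lambda>x. \<Sum>j. cascade m (Suc j) x - cascade m j x) sequentially"
    by (rule Weierstrass_m_test[rotated]) (use cascade_increment in \<open>simp del: cascade.simps\<close>)
  then have "uniform_limit UNIV (\<lambda>n x. cascade m n x - cascade m 0 x)
      (\<lambda>x. \<Sum>j. cascade m (Suc j) x - cascade m j x) sequentially"
    by (simp only: sum_lessThan_telescope[where f = "\<lambda>j. cascade m j _"])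
  from uniform_limit_add[OF this uniform_limit_const[where c = "cascade m 0"]]
  have lim: "uniform_limit UNIV (cascade m)
      (\<lambda>x. (\<Sum>j. cascade m (Suc j) x - cascade m j x) + cascade m 0 x) sequentially"
    by (simp del: cascade.simps)
  have "rough m x = (\<Sum>j. cascade m (Suc j) x - cascade m j x) + cascade m 0 x" for x
    unfolding rough_def by (rule limI) (rule tendsto_uniform_limitI[OF lim], simp)
  then have "rough m = (\<lambda>x. (\<Sum>j. cascade m (Suc j) x - cascade m j x) + cascade m 0 x)"
    by (simp only: fun_eq_iff) simp
  then show ?thesis using lim by (simp del: cascade.simps)
qed

lemma cascade_LIMSEQ: "(\<lambda>j. cascade m j x) \<longlonglongrightarrow> rough m x"
  by (rule tendsto_uniform_limitI[OF uniform_limit_cascade]) simp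

lemma continuous_on_cascade: "continuous_on UNIV (cascade m j)"
  by (induction m j rule: cascade.induct)
     (use bump_on_hat in \<open>auto simp: bump_on_def intro: continuous_on_comb\<close>)

lemma cascade_symmetric: "cascade m j (2 * mesh m - x) = cascade m j x"
proof (induction j arbitrary: m x)
  case 0
  show ?case using bump_on_hat[of "mesh m"] by (simp add: bump_on_def)
next
  case (Suc j)
  define f s where "f = cascade (Suc m) j" and "s = mesh (Suc m)"
  have sym: "f (2 * s - y) = f y" for y unfolding f_def s_def by (rule Suc.IH)
  have "2 * mesh m = 4 * s" by (simp add: s_def)
  moreover have "f (4 * s - x) = f (x - s - s)" "f (4 * s - x - s) = f (x - s)"
      "f (4 * s - x - s - s) = f x"
    using sym[of "x - s - s"] sym[of "x - s"] sym[of x] by (simp_all add: algebra_simps)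
  ultimately show ?case
    unfolding cascade.simps f_def[symmetric] s_def[symmetric] by (simp add: quad_mask_def)
qed

text \<open>Positivity and support survive the limit because the cascade stays between two fixed
  positive multiples of the hat function.\<close>

lemma bump_on_rough: "bump_on (2 * mesh m) (rough m)"
proof -
  have cont: "continuous_on UNIV (rough m)"
    by (rule uniform_limit_theorem[OF _ uniform_limit_cascade]) (auto simp: continuous_on_cascade)
  have lower: "2 powr (- total) * hat (mesh m) x \<le> rough m x" for x
    by (rule LIMSEQ_le_const[OF cascade_LIMSEQ]) (use cascade_bounds in blast)
  have upper: "rough m x \<le> 2 powr total * hat (mesh m) x" for x
    by (rule LIMSEQ_le_const2[OF cascade_LIMSEQ]) (use cascade_bounds in blast)
  note cont
  moreover have "rough m (2 * mesh m - x) = rough m x" for x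
    unfolding rough_def cascade_symmetric ..
  moreover have "0 < rough m x" if "0 < x" "x < 2 * mesh m" for x
  proof -
    have "0 < hat (mesh m) x" using bump_on_hat[of "mesh m"] that by (simp add: bump_on_def)
    then have "0 < 2 powr (- total) * hat (mesh m) x" by simp
    then show ?thesis using lower[of x] by linarith
  qed
  moreover have "rough m x = 0" if "x \<le> 0 \<or> 2 * mesh m \<le> x" for x
  proof -
    have "hat (mesh m) x = 0" using bump_on_hat[of "mesh m"] that by (auto simp: bump_on_def)
    then show ?thesis using lower[of x] upper[of x] by simp
  qed
  ultimately show ?thesis
    unfolding bump_on_def by blast
qed

lemma rough_refinement: "rough m = comb (quad_mask (\<epsilon> m)) (mesh (Suc m)) (rough (Suc m))"
proof
  fix x
  have "(\<lambda>j. cascade m (Suc j) x) \<longlonglongrightarrow> rough m x"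
    using cascade_LIMSEQ by (rule LIMSEQ_Suc)
  moreover have "(\<lambda>j. cascade m (Suc j) x) \<longlonglongrightarrow> comb (quad_mask (\<epsilon> m)) (mesh (Suc m)) (rough (Suc m)) x"
    unfolding cascade.simps by (rule tendsto_comb[OF cascade_LIMSEQ])
  ultimately show "rough m x = comb (quad_mask (\<epsilon> m)) (mesh (Suc m)) (rough (Suc m)) x"
    by (rule LIMSEQ_unique)
qed

lemma integral_cascade: "integrable lborel (cascade m j) \<and> integral\<^sup>L lborel (cascade m j) = 1"
proof (induction m j rule: cascade.induct)
  case (1 m)
  show ?case using integral_hat[of "mesh m"] bump_on_integrable[OF bump_on_hat, of "mesh m"] by simp
next
  case (2 m j)
  then show ?case by (simp add: integrable_comb lebesgue_integral_comb quad_mask_at_1)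
qed

lemma integral_rough: "integral\<^sup>L lborel (rough m) = 1"
proof -
  have "(\<lambda>j. integral\<^sup>L lborel (cascade m j)) \<longlonglongrightarrow> integral\<^sup>L lborel (rough m)"
  proof (rule integral_dominated_convergence[where w = "\<lambda>x. 2 powr total * hat (mesh m) x"])
    show "rough m \<in> borel_measurable lborel" "\<And>j. cascade m j \<in> borel_measurable lborel"
      using borel_measurable_integrable bump_on_integrable[OF bump_on_rough] integral_cascade by blast+
    show "integrable lborel (\<lambda>x. 2 powr total * hat (mesh m) x)"
      using bump_on_integrable[OF bump_on_hat, of "mesh m"] by simp
    show "AE x in lborel. (\<lambda>j. cascade m j x) \<longlonglongrightarrow> rough m x"
      by (simp add: cascade_LIMSEQ)
    have "0 \<le> cascade m j x" for j x
      using cascade_bounds(1)[of m x j] hat_mesh_nonneg[of m x]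
      by (meson mult_nonneg_nonneg order_trans powr_ge_zero)
    then show "AE x in lborel. norm (cascade m j x) \<le> 2 powr total * hat (mesh m) x" for j
      by (simp add: cascade_bounds(2))
  qed
  then show ?thesis using integral_cascade LIMSEQ_unique[OF _ tendsto_const] by auto
qed

text \<open>\<^term>\<open>smooth q m\<close> corresponds to masks with \<open>q\<close> factors \<open>(1 + z) / 2\<close>. Its supporting interval
  has length \<open>(q + 2) / 2^m\<close>.\<close>

fun smooth :: "nat \<Rightarrow> nat \<Rightarrow> real \<Rightarrow> real" where
  "smooth 0 m = rough m"
| "smooth (Suc q) m = coarsen (mesh m) (smooth q m)"

lemma bump_on_smooth: "bump_on (real (q + 2) * mesh m) (smooth q m)"
proof (induction q)
  case 0
  show ?case using bump_on_rough[of m] by simp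
next
  case (Suc q)
  from bump_on_coarsen[OF this, of "mesh m"] show ?case
    by (simp add: field_simps)
qed

lemma continuous_on_smooth: "continuous_on UNIV (smooth q m)"
  using bump_on_smooth[of q m] by (simp add: bump_on_def)

lemma DERIV_smooth:
  "(smooth (Suc q) m has_real_derivative (smooth q m x - smooth q m (x - mesh m)) / mesh m) (at x)"
  unfolding smooth.simps by (rule DERIV_coarsen[OF continuous_on_smooth]) simp

definition smooth_mask :: "nat \<Rightarrow> nat \<Rightarrow> real poly" where
  "smooth_mask q m = [:1/2, 1/2:] ^ q * quad_mask (\<epsilon> m)"

text \<open>Averaging commutes with taking combinations of translates, and the average over the window of level
  \<open>m\<close> is the mean of two averages over windows of level \<open>m + 1\<close>.\<close>

lemma smooth_refinement: "smooth q m = comb (smooth_mask q m) (mesh (Suc m)) (smooth q (Suc m))"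
proof (induction q)
  case 0
  show ?case unfolding smooth_mask_def smooth.simps power_0 mult_1_left by (rule rough_refinement)
next
  case (Suc q)
  have "smooth (Suc q) m = coarsen (2 * mesh (Suc m)) (smooth q m)" by simp
  also have "\<dots> = comb [:1/2, 1/2:] (mesh (Suc m)) (coarsen (mesh (Suc m)) (smooth q m))"
    by (rule coarsen_double[OF continuous_on_smooth]) simp
  also have "coarsen (mesh (Suc m)) (smooth q m)
      = comb (smooth_mask q m) (mesh (Suc m)) (coarsen (mesh (Suc m)) (smooth q (Suc m)))"
    by (subst Suc.IH, rule coarsen_comb[OF continuous_on_smooth]) simp
  also have "comb [:1/2, 1/2:] (mesh (Suc m)) \<dots> = comb (smooth_mask (Suc q) m) (mesh (Suc m)) (smooth (Suc q) (Suc m))"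
    by (simp only: comb_mult[symmetric] smooth_mask_def power_Suc mult.assoc smooth.simps)
  finally show ?case .
qed

lemma integral_smooth: "integral\<^sup>L lborel (smooth q m) = 1"
proof (induction q)
  case 0
  show ?case by (simp add: integral_rough)
next
  case (Suc q)
  have "real (q + 2) * mesh m > 0" by (simp add: field_simps)
  from bump_on_lebesgue_integral_coarsen[OF bump_on_smooth _ this, of "mesh m"] Suc.IH
  show ?case by simp
qed

end

section \<open>Sign patterns of coefficient sequences\<close>

text \<open>At most \<open>N\<close> sign changes, witnessed by a nondecreasing label \<open>\<kappa>\<close> whose parity is the weak sign of each
  entry. Zeros may carry any label, so they need no special treatment; this makes the
  notion easy to propagate.\<close>

definition sign_pattern :: "nat \<Rightarrow> (nat \<Rightarrow> real) \<Rightarrow> bool" where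
  "sign_pattern N v \<longleftrightarrow> (\<exists>\<kappa>. mono \<kappa> \<and> (\<forall>i. \<kappa> i \<le> N \<and> (-1) ^ \<kappa> i * v i \<ge> 0))"

text \<open>Descartes' observation: where the labels of two neighbours have the same parity, a nonnegative
  combination keeps their sign; where they differ, the combination has the sign of one of the
  two, and its label is chosen accordingly. The new labels interleave with the old ones, which
  serves both for monotonicity and for merging the two families in \<open>sign_pattern_upsample_mult\<close>.\<close>

lemma sign_pattern_step:
  fixes v w :: "nat \<Rightarrow> real"
  assumes mono: "mono \<kappa>" and sgn: "\<And>i. (-1) ^ \<kappa> i * v i \<ge> 0"
    and w0: "w 0 = a * v 0" and wS: "\<And>i. w (Suc i) = a * v (Suc i) + b * v i"
    and ab: "a \<ge> 0" "b \<ge> 0"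
  obtains \<kappa>' where "\<And>i. \<kappa>' i \<le> \<kappa> i" "\<And>i. \<kappa> i \<le> \<kappa>' (Suc i)" "\<And>i. (-1) ^ \<kappa>' i * w i \<ge> 0"
proof
  \<comment> \<open>At index \<open>0\<close> both choices coincide, as \<open>0 - 1 = 0\<close>.\<close>
  define \<kappa>' where "\<kappa>' i = (if (-1) ^ \<kappa> i * w i \<ge> 0 then \<kappa> i else \<kappa> (i - 1))" for i
  show "\<kappa>' i \<le> \<kappa> i" "\<kappa> i \<le> \<kappa>' (Suc i)" for i
    by (auto simp: \<kappa>'_def intro!: monoD[OF mono])
  show "(-1) ^ \<kappa>' i * w i \<ge> 0" for i
  proof (cases i)
    case 0
    have "(-1) ^ \<kappa> 0 * w 0 = a * ((-1) ^ \<kappa> 0 * v 0)" by (simp add: w0)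
    then have "(-1) ^ \<kappa> 0 * w 0 \<ge> 0"
      using mult_nonneg_nonneg[OF ab(1) sgn[of 0]] by linarith
    then show ?thesis by (simp add: 0 \<kappa>'_def)
  next
    case (Suc k)
    have nn: "0 \<le> a * ((-1) ^ \<kappa> (Suc k) * v (Suc k)) + b * ((-1) ^ \<kappa> k * v k)"
      using sgn ab by simp
    show ?thesis
    proof (cases "even (\<kappa> (Suc k)) = even (\<kappa> k)")
      case True
      then have "(-1 :: real) ^ \<kappa> k = (-1) ^ \<kappa> (Suc k)"
        by (cases "even (\<kappa> k)") auto
      then have "(-1) ^ \<kappa> (Suc k) * w (Suc k) \<ge> 0"
        using nn by (simp add: wS algebra_simps)
      then show ?thesis by (simp add: Suc \<kappa>'_def)
    next
      case False
      then have "(-1 :: real) ^ \<kappa> k = - ((-1) ^ \<kappa> (Suc k))"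
        by (cases "even (\<kappa> k)") auto
      then show ?thesis by (simp add: Suc \<kappa>'_def)
    qed
  qed
qed

lemma sign_pattern_mult_linear:
  assumes "sign_pattern N (coeff V)" "a \<ge> 0" "b \<ge> 0"
  shows "sign_pattern N (coeff ([:a, b:] * V))"
proof -
  obtain \<kappa> where \<kappa>: "mono \<kappa>" "\<And>i. \<kappa> i \<le> N" "\<And>i. (-1) ^ \<kappa> i * coeff V i \<ge> 0"
    using assms(1) by (auto simp: sign_pattern_def)
  obtain \<kappa>' where \<kappa>': "\<And>i. \<kappa>' i \<le> \<kappa> i" "\<And>i. \<kappa> i \<le> \<kappa>' (Suc i)"
      "\<And>i. (-1) ^ \<kappa>' i * coeff ([:a, b:] * V) i \<ge> 0"
    by (rule sign_pattern_step[OF \<kappa>(1,3), of "coeff ([:a, b:] * V)" a b]) (use assms in auto)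
  have "mono \<kappa>'"
    unfolding mono_iff_le_Suc
  proof
    show "\<kappa>' i \<le> \<kappa>' (Suc i)" for i using order_trans[OF \<kappa>'(1,2)] .
  qed
  then show ?thesis
    unfolding sign_pattern_def using \<kappa>'(3) order_trans[OF \<kappa>'(1) \<kappa>(2)] by blast
qed

lemma sign_pattern_mult_linear_power:
  assumes "sign_pattern N (coeff V)" "a \<ge> 0" "b \<ge> 0"
  shows "sign_pattern N (coeff ([:a, b:] ^ q * V))"
proof (induction q)
  case 0
  then show ?case using assms by simp
next
  case (Suc q)
  have "[:a, b:] ^ Suc q * V = [:a, b:] * ([:a, b:] ^ q * V)"
    by (simp only: power_Suc mult.assoc)
  then show ?case using sign_pattern_mult_linear[OF Suc.IH assms(2,3)] by (simp only:)
qed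

lemma coeff_upsample:
  fixes V :: "real poly"
  shows "coeff (V \<circ>\<^sub>p [:0, 0, 1:]) i = (if even i then coeff V (i div 2) else 0)"
proof (induction V arbitrary: i)
  case 0
  show ?case by simp
next
  case (pCons a V)
  show ?case
  proof (cases i)
    case 0 then show ?thesis by (simp add: pcompose_pCons)
  next
    case (Suc k)
    then show ?thesis by (cases k) (simp_all add: pcompose_pCons pCons.IH)
  qed
qed

text \<open>Entries with odd index are multiples of the old entries, entries with even index are
  sums of two neighbours. The labels of the sums lie between those of the neighbours, so that both families
  merge into one monotone labelling.\<close>

lemma sign_pattern_upsample_mult:
  assumes "sign_pattern N (coeff V)" "a \<ge> 0" "b \<ge> 0"
  shows "sign_pattern N (coeff ([:a, b, a:] * (V \<circ>\<^sub>p [:0, 0, 1:])))"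
proof -
  define w where "w = coeff ([:a, b, a:] * (V \<circ>\<^sub>p [:0, 0, 1:]))"
  define u where "u = coeff ([:a, a:] * V)"
  have weven: "w (2 * i) = u i" for i
  proof (cases i)
    case 0
    show ?thesis
      unfolding 0 w_def u_def
      by (simp add: poly_pcompose poly_0_coeff_0)
  next
    case (Suc k)
    then show ?thesis by (simp add: w_def u_def coeff_upsample)
  qed
  have wodd: "w (Suc (2 * i)) = b * coeff V i" for i
    by (cases i) (simp_all add: w_def coeff_upsample poly_pcompose poly_0_coeff_0)
  obtain \<kappa> where \<kappa>: "mono \<kappa>" "\<And>i. \<kappa> i \<le> N" "\<And>i. (-1) ^ \<kappa> i * coeff V i \<ge> 0"
    using assms(1) by (auto simp: sign_pattern_def)
  have "u 0 = a * coeff V 0" "u (Suc i) = a * coeff V (Suc i) + a * coeff V i" for i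
    by (simp_all add: u_def)
  then obtain \<kappa>' where \<kappa>': "\<And>i. \<kappa>' i \<le> \<kappa> i" "\<And>i. \<kappa> i \<le> \<kappa>' (Suc i)"
      "\<And>i. (-1) ^ \<kappa>' i * u i \<ge> 0"
    using sign_pattern_step[OF \<kappa>(1,3), of u a a] assms by blast
  define \<tau> where "\<tau> i = (if even i then \<kappa>' (i div 2) else \<kappa> (i div 2))" for i
  have "mono \<tau>"
    using \<kappa>' by (auto simp: mono_iff_le_Suc \<tau>_def elim!: oddE)
  moreover have "\<tau> i \<le> N" for i
    using \<kappa>(2) order_trans[OF \<kappa>'(1) \<kappa>(2)] by (simp add: \<tau>_def)
  moreover have "(-1) ^ \<tau> i * w i \<ge> 0" for i
  proof (cases "even i")
    case True
    then obtain k where "i = 2 * k" by blast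
    then show ?thesis using \<kappa>'(3)[of k] by (simp add: \<tau>_def weven)
  next
    case False
    then obtain k where k: "i = Suc (2 * k)" by (auto elim: oddE)
    have "0 \<le> b * ((-1) ^ \<kappa> k * coeff V k)" using \<kappa>(3) assms by simp
    then show ?thesis by (simp add: k \<tau>_def wodd mult.left_commute)
  qed
  ultimately show ?thesis
    unfolding sign_pattern_def w_def[symmetric] by blast
qed

section \<open>Sign changes of functions\<close>

text \<open>The analogue of \<^const>\<open>sign_pattern\<close> for functions. A labelling is only asked for on each finite set of
  points, because the level of refinement that provides it depends on the distances between the points.\<close>

definition alternates_at_most :: "nat \<Rightarrow> (real \<Rightarrow> real) \<Rightarrow> bool" where
  "alternates_at_most N f \<longleftrightarrow> (\<forall>X. finite X \<longrightarrow> (\<exists>\<kappa>.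
     (\<forall>x\<in>X. \<kappa> x \<le> N \<and> (-1) ^ \<kappa> x * f x \<ge> 0) \<and>
     (\<forall>x\<in>X. \<forall>y\<in>X. x < y \<and> f x \<noteq> 0 \<and> f y \<noteq> 0 \<longrightarrow> \<kappa> x \<le> \<kappa> y)))"

lemma opposite_signs_parity:
  fixes x y :: real
  assumes "(-1) ^ k * x \<ge> 0" "(-1) ^ l * y \<ge> 0" "x * y < 0"
  shows "k \<noteq> l"
proof
  assume "k = l"
  then have "0 \<le> ((-1) ^ k * x) * ((-1) ^ k * y)" using assms by (intro mult_nonneg_nonneg[of "(-1) ^ k * x"]) simp_all
  also have "\<dots> = ((-1) ^ k * (-1) ^ k) * (x * y)" by (simp only: mult_ac)
  also have "(-1 :: real) ^ k * (-1) ^ k = 1" by (simp add: power_mult_distrib[symmetric])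
  finally show False using assms by simp
qed

text \<open>Each sign change forces the label to increase, and labels lie between \<open>0\<close> and \<open>N\<close>.\<close>

lemma list_sign_changes_le:
  assumes "alternates_at_most N f" "sorted_wrt (<) xs"
  shows "list_sign_changes (map f xs) \<le> N"
proof -
  define zs where "zs = filter (\<lambda>x. f x \<noteq> 0) xs"
  have filt: "filter (\<lambda>y. y \<noteq> 0) (map f xs) = map f zs"
    by (simp add: zs_def filter_map o_def)
  have sorted: "sorted_wrt (<) zs" unfolding zs_def by (rule sorted_wrt_filter) fact
  have nz: "f x \<noteq> 0" if "x \<in> set zs" for x using that by (simp add: zs_def)
  obtain \<kappa> where \<kappa>: "\<And>x. x \<in> set zs \<Longrightarrow> \<kappa> x \<le> N" "\<And>x. x \<in> set zs \<Longrightarrow> (-1) ^ \<kappa> x * f x \<ge> 0"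
      "\<And>x y. x \<in> set zs \<Longrightarrow> y \<in> set zs \<Longrightarrow> x < y \<Longrightarrow> \<kappa> x \<le> \<kappa> y"
    using assms(1)[unfolded alternates_at_most_def, rule_format, of "set zs", OF finite_set] nz
    by blast
  define k where "k i = \<kappa> (zs ! i)" for i
  have mono: "k i \<le> k j" if "i \<le> j" "j < length zs" for i j
    using that sorted_wrt_nth_less[OF sorted, of i j] \<kappa>(3)[of "zs ! i" "zs ! j"]
    by (cases "i = j") (auto simp: k_def)
  define A where "A = {i. Suc i < length zs \<and> f (zs ! i) * f (zs ! Suc i) < 0}"
  have jump: "k i < k (Suc i)" if "i \<in> A" for i
  proof -
    have "k i \<noteq> k (Suc i)"
      unfolding k_def
      by (rule opposite_signs_parity[OF \<kappa>(2) \<kappa>(2)]) (use that in \<open>auto simp: A_def\<close>)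
    moreover have "k i \<le> k (Suc i)" using that by (intro mono) (auto simp: A_def)
    ultimately show ?thesis by simp
  qed
  have "card A \<le> card {1..N}"
  proof (rule card_inj_on_le)
    have less: "k (Suc i) < k (Suc j)" if "i \<in> A" "j \<in> A" "i < j" for i j
      using that mono[of "Suc i" j] jump[OF that(2)] by (auto simp: A_def)
    show "inj_on (\<lambda>i. k (Suc i)) A"
      by (rule inj_onI) (metis less less_irrefl linorder_neqE_nat)
    have "k (Suc i) \<in> {1..N}" if "i \<in> A" for i
      using jump[OF that] \<kappa>(1)[of "zs ! Suc i"] that by (auto simp: A_def k_def)
    then show "(\<lambda>i. k (Suc i)) ` A \<subseteq> {1..N}" by blast
  qed simp
  also have "A = {i. Suc i < length (map f zs) \<and> map f zs ! i * map f zs ! Suc i < 0}"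
    by (auto simp: A_def)
  finally show ?thesis by (simp add: list_sign_changes_def filt Let_def)
qed

lemma sign_changes_le:
  assumes "alternates_at_most N f"
  shows "sign_changes f \<le> enat N"
  unfolding sign_changes_def
  by (rule SUP_least) (use list_sign_changes_le[OF assms] in auto)

lemma finite_set_separated:
  fixes X :: "real set"
  assumes "finite X"
  obtains \<delta> where "\<delta> > 0" "\<And>x y. x \<in> X \<Longrightarrow> y \<in> X \<Longrightarrow> x < y \<Longrightarrow> \<delta> \<le> y - x"
proof -
  define D where "D = insert 1 ((\<lambda>(x, y). y - x) ` {p \<in> X \<times> X. fst p < snd p})"
  have fin: "finite D" using assms by (simp add: D_def)
  show ?thesis
  proof (rule that[of "Min D"])
    show "Min D > 0" using fin by (subst Min_gr_iff) (auto simp: D_def)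
    show "Min D \<le> y - x" if "x \<in> X" "y \<in> X" "x < y" for x y
      by (rule Min_le[OF fin]) (use that in \<open>auto simp: D_def intro!: rev_image_eqI[of "(x, y)"]\<close>)
  qed
qed

context perturbed_cascade
begin

text \<open>Refinement does not create sign changes in the coefficients: substituting \<open>z^2\<close> only inserts zeros, the
  quadratic factor is dealt with by \<open>sign_pattern_upsample_mult\<close>, and the remaining factors are linear with
  nonnegative coefficients.\<close>

lemma smooth_comb_refine:
  assumes "sign_pattern N (coeff V)"
  obtains W where "sign_pattern N (coeff W)"
    "comb V (mesh m) (smooth q m) = comb W (mesh (m + j)) (smooth q (m + j))"
proof -
  have "\<exists>W. sign_pattern N (coeff W) \<and>
      comb V (mesh m) (smooth q m) = comb W (mesh (m + j)) (smooth q (m + j))"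
  proof (induction j)
    case 0
    show ?case using assms by (intro exI[of _ V]) simp
  next
    case (Suc j)
    then obtain W where W: "sign_pattern N (coeff W)"
      "comb V (mesh m) (smooth q m) = comb W (mesh (m + j)) (smooth q (m + j))" by blast
    let ?k = "m + j"
    define U where "U = W \<circ>\<^sub>p [:0, 0, 1:] * smooth_mask q ?k"
    have "comb W (mesh ?k) (smooth q ?k) = comb W (2 * mesh (Suc ?k)) (smooth q ?k)" by simp
    also have "\<dots> = comb (W \<circ>\<^sub>p [:0, 0, 1:]) (mesh (Suc ?k))
        (comb (smooth_mask q ?k) (mesh (Suc ?k)) (smooth q (Suc ?k)))"
      by (simp only: comb_upsample smooth_refinement[of q ?k])
    also have "\<dots> = comb U (mesh (Suc ?k)) (smooth q (Suc ?k))"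
      by (simp only: U_def comb_mult)
    finally have "comb V (mesh m) (smooth q m) = comb U (mesh (m + Suc j)) (smooth q (m + Suc j))"
      using W(2) by simp
    moreover have "sign_pattern N (coeff U)"
    proof -
      have "U = [:1/2, 1/2:] ^ q * (quad_mask (\<epsilon> ?k) * (W \<circ>\<^sub>p [:0, 0, 1:]))"
        by (simp only: U_def smooth_mask_def mult_ac)
      moreover have "0 \<le> 2 powr (- \<epsilon> ?k) / 4" "0 \<le> 1 - 2 powr (- \<epsilon> ?k) / 2"
        using powr_minus_bounds[OF \<epsilon>_nonneg[of ?k]] by auto
      then have "sign_pattern N (coeff (quad_mask (\<epsilon> ?k) * (W \<circ>\<^sub>p [:0, 0, 1:])))"
        unfolding quad_mask_def by (rule sign_pattern_upsample_mult[OF W(1)])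
      then have "sign_pattern N (coeff ([:1/2, 1/2:] ^ q * (quad_mask (\<epsilon> ?k) * (W \<circ>\<^sub>p [:0, 0, 1:]))))"
        by (rule sign_pattern_mult_linear_power) auto
      ultimately show ?thesis by simp
    qed
    ultimately show ?case by blast
  qed
  then show ?thesis using that by blast
qed

text \<open>For a finite set \<open>X\<close> of points, refine until the supports of the translates are shorter than the
  gaps of \<open>X\<close>. A point with a nonzero value then has a coefficient of the same sign in the short window to its
  left. Windows of different points are disjoint, so the order of the coefficients is the order of the points.\<close>

lemma comb_smooth_alternates:
  assumes "sign_pattern N (coeff V)"
  shows "alternates_at_most N (comb V (mesh m) (smooth q m))"
  unfolding alternates_at_most_def
proof (intro allI impI)
  fix X :: "real set" assume "finite X"
  define F where "F = comb V (mesh m) (smooth q m)"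
  obtain \<delta> where \<delta>: "\<delta> > 0" "\<And>x y. x \<in> X \<Longrightarrow> y \<in> X \<Longrightarrow> x < y \<Longrightarrow> \<delta> \<le> y - x"
    using finite_set_separated[OF \<open>finite X\<close>] by blast
  have "(\<lambda>j. real (q + 2) * (1 / 2) ^ j) \<longlonglongrightarrow> real (q + 2) * 0"
    by (intro tendsto_intros LIMSEQ_power_zero) auto
  then have "\<forall>\<^sub>F j in sequentially. real (q + 2) * (1 / 2) ^ j < \<delta>"
    using \<delta>(1) by (intro order_tendstoD(2)) simp_all
  then obtain j where j: "real (q + 2) * (1 / 2) ^ j < \<delta>"
    by (auto simp: eventually_sequentially)
  define k where "k = m + j"
  have "real (q + 2) * mesh k \<le> real (q + 2) * (1 / 2) ^ j"
    unfolding k_def by (intro mult_left_mono) (auto simp: power_add field_simps)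
  with j have k: "real (q + 2) * mesh k < \<delta>" by linarith
  obtain W where W: "sign_pattern N (coeff W)" "F = comb W (mesh k) (smooth q k)"
    unfolding F_def k_def by (rule smooth_comb_refine[OF assms])
  obtain \<tau> where \<tau>: "mono \<tau>" "\<And>i. \<tau> i \<le> N" "\<And>i. (-1) ^ \<tau> i * coeff W i \<ge> 0"
    using W(1) by (auto simp: sign_pattern_def)
  have "\<exists>i. F x * coeff W i > 0 \<and> 0 < x - real i * mesh k \<and> x - real i * mesh k < real (q + 2) * mesh k"
    if "F x \<noteq> 0" for x
  proof -
    \<comment> \<open>Multiplying the representation of \<open>F x\<close> by \<open>F x\<close> treats both signs at once.\<close>
    have "0 < F x * F x" using that by (auto simp: zero_less_mult_iff)
    also have "F x * F x = (\<Sum>i\<le>degree W. F x * coeff W i * smooth q k (x - real i * mesh k))"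
      by (subst (2) W(2)) (simp add: comb_def sum_distrib_left mult.assoc)
    finally obtain i where i: "0 < F x * coeff W i * smooth q k (x - real i * mesh k)"
      by (meson not_le sum_nonpos)
    have "smooth q k (x - real i * mesh k) \<ge> 0" by (rule bump_on_nonneg[OF bump_on_smooth])
    with i have "smooth q k (x - real i * mesh k) > 0" "F x * coeff W i > 0"
      by (auto simp: zero_less_mult_iff)
    moreover from this have "\<not> (x - real i * mesh k \<le> 0 \<or> real (q + 2) * mesh k \<le> x - real i * mesh k)"
      using bump_on_smooth[of q k] unfolding bump_on_def by (metis less_irrefl)
    ultimately show ?thesis by (auto simp: not_le)
  qed
  then obtain idx where idx: "\<And>x. F x \<noteq> 0 \<Longrightarrow> F x * coeff W (idx x) > 0"
      "\<And>x. F x \<noteq> 0 \<Longrightarrow> 0 < x - real (idx x) * mesh k"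
      "\<And>x. F x \<noteq> 0 \<Longrightarrow> x - real (idx x) * mesh k < real (q + 2) * mesh k"
    by metis
  have "(-1) ^ \<tau> (idx x) * F x \<ge> 0" for x
  proof (cases "F x = 0")
    case False
    have "0 \<le> ((-1) ^ \<tau> (idx x) * coeff W (idx x)) * (F x * coeff W (idx x))"
      using mult_nonneg_nonneg[OF \<tau>(3)[of "idx x"], of "F x * coeff W (idx x)"] idx(1)[OF False] by simp
    also have "\<dots> = ((-1) ^ \<tau> (idx x) * F x) * (coeff W (idx x))\<^sup>2"
      by (simp add: power2_eq_square mult_ac)
    finally show ?thesis
      using idx(1)[OF False] by (auto simp: zero_le_mult_iff)
  qed simp
  moreover have "\<tau> (idx x) \<le> \<tau> (idx y)" if "x \<in> X" "y \<in> X" "x < y" "F x \<noteq> 0" "F y \<noteq> 0" for x y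
  proof (rule monoD[OF \<tau>(1)])
    have "real (idx x) * mesh k < x" using idx(2)[OF that(4)] by simp
    also have "x \<le> y - real (q + 2) * mesh k" using \<delta>(2)[OF that(1,2,3)] k by linarith
    also have "\<dots> < real (idx y) * mesh k" using idx(3)[OF that(5)] by linarith
    finally show "idx x \<le> idx y" by (simp add: divide_less_cancel)
  qed
  ultimately show "\<exists>\<kappa>. (\<forall>x\<in>X. \<kappa> x \<le> N \<and> (-1) ^ \<kappa> x * comb V (mesh m) (smooth q m) x \<ge> 0) \<and>
     (\<forall>x\<in>X. \<forall>y\<in>X. x < y \<and> comb V (mesh m) (smooth q m) x \<noteq> 0 \<and>
        comb V (mesh m) (smooth q m) y \<noteq> 0 \<longrightarrow> \<kappa> x \<le> \<kappa> y)"
    unfolding F_def[symmetric] using \<tau>(2) by (intro exI[of _ "\<lambda>x. \<tau> (idx x)"]) blast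
qed

end

section \<open>Unimodality and bell shape\<close>

text \<open>Strictness up to half a window \<open>s\<close> before the midpoint is what the first average of
  \<^const>\<open>perturbed_cascade.rough\<close> provides, and it suffices for comparing values at a
  distance of at least \<open>s\<close>.\<close>

definition unimodal_on :: "real \<Rightarrow> real \<Rightarrow> (real \<Rightarrow> real) \<Rightarrow> bool" where
  "unimodal_on s L f \<longleftrightarrow> bump_on L f \<and> mono_on {0..L / 2} f \<and> strict_mono_on {0..(L - s) / 2} f"

text \<open>For \<open>0 < x < (L + d) / 2\<close>, the point \<open>x\<close> is closer to the midpoint \<open>L / 2\<close> than \<open>x - d\<close>. After reflecting \<open>x\<close> to
  the left half if necessary, both points lie in the increasing part; and \<open>x - d\<close> lies
  below \<open>(L - s) / 2\<close>, in the part where the increase is strict.\<close>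

lemma unimodal_on_translate_less:
  assumes "unimodal_on s L f" "s > 0" "s \<le> d" "d \<le> L" "0 < x" "x < (L + d) / 2"
  shows "f (x - d) < f x"
proof -
  have b: "bump_on L f" and mono: "mono_on {0..L / 2} f" and strict: "strict_mono_on {0..(L - s) / 2} f"
    using assms(1) by (auto simp: unimodal_on_def)
  have pos: "\<And>x. 0 < x \<Longrightarrow> x < L \<Longrightarrow> f x > 0" and zero: "\<And>x. x \<le> 0 \<or> L \<le> x \<Longrightarrow> f x = 0"
    and sym: "\<And>x. f (L - x) = f x" using b by (auto simp: bump_on_def)
  show ?thesis
  proof (cases "x - d \<le> 0")
    case True
    have "x < L" using assms by simp
    then show ?thesis using pos[of x] zero[of "x - d"] True assms by simp
  next
    case False
    define y where "y = min x (L - x)"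
    have fy: "f y = f x" using sym by (auto simp: y_def min_def)
    have y: "x - d < y" "y \<le> L / 2" using assms by (auto simp: y_def min_def)
    have xd: "x - d < (L - s) / 2" using assms by simp
    have "f (x - d) < f y"
    proof (cases "y \<le> (L - s) / 2")
      case True
      show ?thesis
        by (rule strict_mono_onD[OF strict]) (use y True False xd in auto)
    next
      case y2: False
      have "f (x - d) < f ((L - s) / 2)"
        by (rule strict_mono_onD[OF strict]) (use xd False in auto)
      also have "\<dots> \<le> f y"
        by (rule mono_onD[OF mono]) (use y y2 assms in auto)
      finally show ?thesis .
    qed
    then show ?thesis using fy by simp
  qed
qed

lemma strict_mono_on_by_derivative:
  fixes f :: "real \<Rightarrow> real"
  assumes "\<And>x. (f has_real_derivative f' x) (at x)" "\<And>x. a < x \<Longrightarrow> x < b \<Longrightarrow> f' x > 0"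
  shows "strict_mono_on {a..b} f"
proof (rule strict_mono_onI)
  fix x y assume xy: "x \<in> {a..b}" "y \<in> {a..b}" "x < y"
  show "f x < f y"
  proof (rule DERIV_pos_imp_increasing_open[OF xy(3)])
    show "\<exists>d. (f has_real_derivative d) (at z) \<and> 0 < d" if "x < z" "z < y" for z
      using assms(1)[of z] assms(2)[of z] that xy by auto
  qed (rule DERIV_continuous_UNIV[OF assms(1)])
qed

lemma mono_on_by_derivative:
  fixes f :: "real \<Rightarrow> real"
  assumes "\<And>x. (f has_real_derivative f' x) (at x)" "\<And>x. a \<le> x \<Longrightarrow> x \<le> b \<Longrightarrow> f' x \<ge> 0"
  shows "mono_on {a..b} f"
proof (rule mono_onI)
  fix x y assume xy: "x \<in> {a..b}" "y \<in> {a..b}" "x \<le> y"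
  show "f x \<le> f y"
  proof (rule DERIV_nonneg_imp_nondecreasing[OF xy(3)])
    show "\<exists>d. (f has_real_derivative d) (at z) \<and> 0 \<le> d" if "x \<le> z" "z \<le> y" for z
      using assms(1)[of z] assms(2)[of z] that xy by auto
  qed
qed

lemma unimodal_on_coarsen:
  assumes "unimodal_on s L f" "s > 0" "s \<le> d" "d \<le> L"
  shows "bump_on (L + d) (coarsen d f)"
    "\<And>x. 0 < x \<Longrightarrow> x < (L + d) / 2 \<Longrightarrow> (f x - f (x - d)) / d > 0"
    "strict_mono_on {0..(L + d) / 2} (coarsen d f)"
proof -
  have b: "bump_on L f" using assms(1) by (simp add: unimodal_on_def)
  then have cont: "continuous_on UNIV f" by (simp add: bump_on_def)
  show "bump_on (L + d) (coarsen d f)" by (rule bump_on_coarsen[OF b]) (use assms in auto)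
  show pos: "(f x - f (x - d)) / d > 0" if "0 < x" "x < (L + d) / 2" for x
    using unimodal_on_translate_less[OF assms that] assms(2,3) by simp
  show "strict_mono_on {0..(L + d) / 2} (coarsen d f)"
    by (rule strict_mono_on_by_derivative[OF DERIV_coarsen[OF cont] pos]) (use assms in auto)
qed

context perturbed_cascade
begin

text \<open>For the first average, the derivative \<open>F x / h\<close> with \<open>F x = rough m x - rough m (x - h)\<close> is antisymmetric
  about the midpoint \<open>3 h / 2\<close> and positive on \<open>{0<..h}\<close>. If it were negative at some \<open>x\<close> in the left half,
  it would have the signs \<open>+, -, +\<close> at \<open>h\<close>, \<open>x\<close> and \<open>3 h - x\<close>, although its
  coefficients \<open>1, -1\<close> allow only one sign change.\<close>

lemma unimodal_on_smooth: "unimodal_on (mesh m) (real (q + 3) * mesh m) (smooth (Suc q) m)"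
proof (induction q)
  case 0
  define h where "h = mesh m"
  have h: "h > 0" by (simp add: h_def)
  define F where "F = comb [:1, -1:] h (rough m)"
  have F: "F x = rough m x - rough m (x - h)" for x by (simp add: F_def)
  have b: "bump_on (2 * h) (rough m)" unfolding h_def by (rule bump_on_rough)
  have b1: "bump_on (3 * h) (smooth 1 m)" using bump_on_smooth[of 1 m] by (simp add: h_def)
  have D: "(smooth 1 m has_real_derivative F x / h) (at x)" for x
    using DERIV_smooth[of 0 m x] by (simp add: F h_def)
  have F_sym: "F (3 * h - x) = - F x" for x
  proof -
    have "\<And>x. rough m (2 * h - x) = rough m x" using b by (simp add: bump_on_def)
    from this[of "x - h"] this[of x] show ?thesis by (simp add: F algebra_simps)
  qed
  have F_pos: "F x > 0" if "0 < x" "x \<le> h" for x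
    using b that h unfolding bump_on_def F by simp
  have "sign_pattern 1 (coeff [:1, -1:])"
    unfolding sign_pattern_def
    by (rule exI[of _ "\<lambda>i. min i 1"]) (auto simp: mono_def coeff_pCons split: nat.splits)
  then have alt: "alternates_at_most 1 F"
    using comb_smooth_alternates[of 1 _ m 0] by (simp add: F_def h_def del: comb_pCons)
  have F_nonneg: "F x \<ge> 0" if "0 \<le> x" "x \<le> 3 * h / 2" for x
  proof (rule ccontr)
    assume "\<not> F x \<ge> 0"
    then have neg: "F x < 0" by simp
    have "x \<noteq> 3 * h - x"
    proof
      assume "x = 3 * h - x"
      then have "F x = - F x" using F_sym[of x] by (rule back_subst[of "\<lambda>y. F y = - F x", OF _ sym, rotated])
      with neg show False by simp
    qed
    have "F 0 = 0" using b h unfolding bump_on_def F by simp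
    then have "x > h" using F_pos[of x] neg that by force
    define y where "y = 3 * h - x"
    have y: "x < y" "F y > 0" using that neg F_sym[of x] \<open>x \<noteq> 3 * h - x\<close> by (auto simp: y_def)
    obtain \<kappa> where \<kappa>: "\<kappa> h \<le> 1" "\<kappa> x \<le> 1" "\<kappa> y \<le> (1::nat)"
        "(-1) ^ \<kappa> h * F h \<ge> 0" "(-1) ^ \<kappa> x * F x \<ge> 0" "(-1) ^ \<kappa> y * F y \<ge> 0"
        "\<kappa> h \<le> \<kappa> x" "\<kappa> x \<le> \<kappa> y"
      using alt[unfolded alternates_at_most_def, rule_format, of "{h, x, y}"] F_pos[of h] neg y h \<open>x > h\<close>
      by auto
    have "\<kappa> h \<noteq> \<kappa> x"
      by (rule opposite_signs_parity[OF \<kappa>(4,5)]) (use F_pos[of h] neg h in \<open>simp add: mult_pos_neg\<close>)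
    moreover have "\<kappa> x \<noteq> \<kappa> y"
      by (rule opposite_signs_parity[OF \<kappa>(5,6)]) (use y neg in \<open>simp add: mult_neg_pos\<close>)
    ultimately show False using \<kappa> by linarith
  qed
  have "mono_on {0..3 * h / 2} (smooth 1 m)"
    by (rule mono_on_by_derivative[OF D]) (use F_nonneg h in auto)
  moreover have "strict_mono_on {0..(3 * h - h) / 2} (smooth 1 m)"
    by (rule strict_mono_on_by_derivative[OF D]) (use F_pos h in auto)
  ultimately have "unimodal_on h (3 * h) (smooth 1 m)"
    using b1 by (simp add: unimodal_on_def)
  then show ?case by (simp add: h_def)
next
  case (Suc q)
  define h L where "h = mesh m" and "L = real (q + 3) * h"
  have h: "h > 0" "h \<le> L" by (simp_all add: h_def L_def field_simps)
  have L: "real (Suc q + 3) * mesh m = L + h" by (simp add: L_def h_def field_simps)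
  have "unimodal_on h L (smooth (Suc q) m)" using Suc.IH by (simp only: h_def L_def)
  note u = unimodal_on_coarsen[OF this h(1) order_refl h(2)]
  have eq: "smooth (Suc (Suc q)) m = coarsen h (smooth (Suc q) m)" by (simp only: smooth.simps h_def)
  show ?case
    unfolding L eq unfolding h_def[symmetric] unimodal_on_def
    using u(1,3) h by (auto simp: strict_mono_on_def
        intro!: strict_mono_on_imp_mono_on)
qed

text \<open>The last window may have length \<^term>\<open>mesh m\<close> or twice that; the second case serves for the
  mask of level \<open>0\<close>, which has a single factor \<open>(1 + z) / 2\<close>.\<close>

theorem bell_shaped_coarsen_smooth:
  assumes d: "d = mesh m \<or> d = 2 * mesh m"
  shows "bell_shaped (coarsen d (smooth (Suc p) m))"
proof -
  define h L where "h = mesh m" and "L = real (p + 3) * h"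
  define f where "f = smooth (Suc p) m"
  define \<phi> where "\<phi> = coarsen d f"
  define \<phi>' where "\<phi>' x = (f x - f (x - d)) / d" for x
  define c where "c = (L + d) / 2"
  have dh: "d = h \<or> d = 2 * h" using d by (simp add: h_def)
  have "h > 0" by (simp add: h_def)
  moreover from this have "3 * h \<le> L" unfolding L_def by (intro mult_right_mono) auto
  ultimately have h: "h > 0" "h \<le> d" "d \<le> L" and dpos: "d > 0" using dh by auto
  have uni: "unimodal_on h L f"
    unfolding f_def h_def L_def by (rule unimodal_on_smooth)
  note u = unimodal_on_coarsen[OF uni h, folded \<phi>_def \<phi>'_def c_def]
  have cont: "continuous_on UNIV f" unfolding f_def by (rule continuous_on_smooth)
  have D1: "(\<phi> has_real_derivative \<phi>' x) (at x)" for x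
    unfolding \<phi>_def \<phi>'_def by (rule DERIV_coarsen[OF cont]) (use dpos in simp)
  define f' where "f' x = comb [:1, -1:] h (smooth p m) x / h" for x
  have Df: "(f has_real_derivative f' x) (at x)" for x
    using DERIV_smooth[of p m x] by (simp add: f_def f'_def h_def)
  define \<phi>'' where "\<phi>'' x = (f' x - f' (x - d)) / d" for x
  have D2: "(\<phi>' has_real_derivative \<phi>'' x) (at x)" for x
    unfolding \<phi>'_def \<phi>''_def
    by (intro DERIV_cdivide DERIV_diff Df DERIV_translate)
  have c2: "L + d = 2 * c" and cpos: "c > 0" using h dpos by (simp_all add: c_def)
  have len: "supp_length \<phi> = 2 * c"
    using bump_on_supp(2)[OF u(1)] cpos by (simp add: c2)
  have sym: "centrally_symmetric \<phi>"
    using u(1) unfolding centrally_symmetric_def len bump_on_def c2 by simp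
  have f_sym: "f (L - x) = f x" and f_zero: "x \<le> 0 \<or> L \<le> x \<Longrightarrow> f x = 0" for x
    using uni by (auto simp: unimodal_on_def bump_on_def)
  have \<phi>'_sym: "\<phi>' (2 * c - x) = - \<phi>' x" for x
  proof -
    have e: "2 * c - x = L - (x - d)" "2 * c - x - d = L - x" using c2 by simp_all
    have "\<phi>' (2 * c - x) = (f (x - d) - f x) / d"
      unfolding \<phi>'_def e(2) unfolding e(1) f_sym ..
    then show ?thesis by (simp add: \<phi>'_def minus_divide_left)
  qed
  have \<phi>'_0: "\<phi>' 0 = 0" using f_zero[of 0] f_zero[of "-d"] dpos by (simp add: \<phi>'_def)
  have mvt: "\<exists>z. a < z \<and> z < b \<and> \<phi>' b - \<phi>' a = (b - a) * \<phi>'' z" if "a < b" for a b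
    using MVT2[OF that, of \<phi>' \<phi>''] D2 by blast
  have \<phi>'_c: "\<phi>' c = 0" using \<phi>'_sym[of c] by simp
  have pos: "\<phi>' (c / 2) > 0" using u(2)[of "c / 2"] cpos by simp
  have \<phi>'_right: "\<phi>' (3 * c / 2) < 0" "\<phi>' (2 * c) = 0"
    using \<phi>'_sym[of "c / 2"] \<phi>'_sym[of 0] pos \<phi>'_0 by (simp_all add: field_simps)
  \<comment> \<open>\<^term>\<open>\<phi>'\<close> takes the signs \<open>0, +, 0, -, 0\<close> at \<open>0\<close>, \<open>c / 2\<close>, \<open>c\<close>, \<open>3 * c / 2\<close>, \<open>2 * c\<close>.\<close>
  obtain x\<^sub>1 where x\<^sub>1: "0 < x\<^sub>1" "x\<^sub>1 < c / 2" "\<phi>' (c / 2) - \<phi>' 0 = (c / 2 - 0) * \<phi>'' x\<^sub>1"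
    using mvt[of 0 "c / 2"] cpos by auto
  then have "0 < (c / 2) * \<phi>'' x\<^sub>1" using pos \<phi>'_0 by simp
  then have p1: "\<phi>'' x\<^sub>1 > 0" using cpos by (simp add: zero_less_mult_iff)
  obtain x\<^sub>2 where x\<^sub>2: "c / 2 < x\<^sub>2" "x\<^sub>2 < c" "\<phi>' c - \<phi>' (c / 2) = (c - c / 2) * \<phi>'' x\<^sub>2"
    using mvt[of "c / 2" c] cpos by auto
  then have "(c / 2) * \<phi>'' x\<^sub>2 < 0" using pos \<phi>'_c by simp
  then have p2: "\<phi>'' x\<^sub>2 < 0" using cpos by (simp add: mult_less_0_iff)
  obtain x\<^sub>3 where x\<^sub>3: "3 * c / 2 < x\<^sub>3" "x\<^sub>3 < 2 * c"
      "\<phi>' (2 * c) - \<phi>' (3 * c / 2) = (2 * c - 3 * c / 2) * \<phi>'' x\<^sub>3"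
    using mvt[of "3 * c / 2" "2 * c"] cpos by auto
  then have "0 < (c / 2) * \<phi>'' x\<^sub>3" using \<phi>'_right by simp
  then have p3: "\<phi>'' x\<^sub>3 > 0" using cpos by (simp add: zero_less_mult_iff)
  have "enat (list_sign_changes (map \<phi>'' [x\<^sub>1, x\<^sub>2, x\<^sub>3])) \<le> sign_changes \<phi>''"
    unfolding sign_changes_def by (rule SUP_upper) (use x\<^sub>1 x\<^sub>2 x\<^sub>3 cpos in auto)
  moreover have "list_sign_changes (map \<phi>'' [x\<^sub>1, x\<^sub>2, x\<^sub>3]) = 2"
  proof -
    let ?ys = "[\<phi>'' x\<^sub>1, \<phi>'' x\<^sub>2, \<phi>'' x\<^sub>3]"
    have filt: "filter (\<lambda>y. y \<noteq> 0) (map \<phi>'' [x\<^sub>1, x\<^sub>2, x\<^sub>3]) = ?ys" using p1 p2 p3 by simp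
    have set: "{i. Suc i < length ?ys \<and> ?ys ! i * ?ys ! Suc i < 0} = {0, 1}"
      using p1 p2 p3 by (auto simp: less_Suc_eq mult_pos_neg mult_neg_pos)
    show ?thesis unfolding list_sign_changes_def Let_def filt set by simp
  qed
  ultimately have ge: "sign_changes \<phi>'' \<ge> 2" by (simp add: numeral_eq_enat)
  \<comment> \<open>The coefficients \<open>1, -1\<close> come from the derivative of \<open>f\<close>, the factor \<open>D\<close> from the last average.\<close>
  have V: "\<phi>'' = comb (smult (1 / (h * d)) (D * [:1, -1:])) h (smooth p m)"
    if "\<And>g x. comb D h g x = g x - g (x - d)" for D
    by (simp add: fun_eq_iff comb_smult comb_mult that \<phi>''_def f'_def diff_divide_distrib del: comb_pCons mult_pCons_right)
  have "\<exists>V. sign_pattern 2 (coeff V) \<and> \<phi>'' = comb V h (smooth p m)"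
  proof (cases "d = h")
    case True
    have "sign_pattern 2 (coeff (smult (1 / (h * d)) ([:1, -1:] * [:1, -1:])))"
      unfolding sign_pattern_def using h
      by (intro exI[of _ "\<lambda>i. min i 2"]) (auto simp: mono_def coeff_pCons numeral_2_eq_2 split: nat.splits)
    then show ?thesis using V[of "[:1, -1:]"] True by force
  next
    case False
    with dh have "d = 2 * h" by simp
    \<comment> \<open>Up to the factor, the coefficients are those of \<open>(1 - z^2) (1 - z) = 1 - z - z^2 + z^3\<close>.\<close>
    have "sign_pattern 2 (coeff (smult (1 / (h * d)) ([:1, 0, -1:] * [:1, -1:])))"
      unfolding sign_pattern_def using h
      by (intro exI[of _ "\<lambda>i. if i = 0 then 0 else if i \<le> 2 then 1 else 2"])
         (auto simp: mono_def coeff_pCons split: nat.splits)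
    then show ?thesis using V[of "[:1, 0, -1:]"] \<open>d = 2 * h\<close> by force
  qed
  then have "alternates_at_most 2 \<phi>''"
    using comb_smooth_alternates unfolding h_def by metis
  then have "sign_changes \<phi>'' \<le> 2" using sign_changes_le by (metis numeral_eq_enat)
  with ge have "sign_changes \<phi>'' = 2" by simp
  moreover have "strict_mono_on {0..supp_length \<phi> / 2} \<phi>"
    using u(3) by (simp add: len)
  ultimately show ?thesis
    unfolding bell_shaped_def \<phi>_def[symmetric] f_def[symmetric] using sym D1 D2 by blast
qed

end

section \<open>Fourier transforms\<close>

abbreviation (input) wave :: "real \<Rightarrow> real \<Rightarrow> complex" where
  "wave \<omega> x \<equiv> exp (- \<i> * complex_of_real (\<omega> * x))"

lemma wave_eq_iexp: "wave \<omega> x = iexp (- \<omega> * x)"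
  by (simp add: algebra_simps)

lemma norm_wave: "cmod (wave \<omega> x) = 1"
  unfolding wave_eq_iexp by (rule norm_exp_i_times)

lemma integrable_fourier:
  assumes "integrable lborel f"
  shows "integrable lborel (\<lambda>x. complex_of_real (f x) * wave \<omega> x)"
proof (rule Bochner_Integration.integrable_bound[OF assms])
  have [measurable]: "f \<in> borel_measurable borel"
    using borel_measurable_integrable[OF assms] by simp
  have [measurable]: "(\<lambda>x. wave \<omega> x) \<in> borel_measurable borel"
    by (intro borel_measurable_continuous_onI continuous_intros)
  show "(\<lambda>x. complex_of_real (f x) * wave \<omega> x) \<in> borel_measurable lborel"
    by simp
  show "AE x in lborel. norm (complex_of_real (f x) * wave \<omega> x) \<le> norm (f x)"
    by (simp add: norm_mult norm_wave del: mult_minus_left)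
qed

lemma fourier_cmult: "fourier (\<lambda>x. c * f x) \<omega> = complex_of_real c * fourier f \<omega>"
  by (simp add: fourier_def mult.assoc)

lemma fourier_add:
  assumes "integrable lborel f" "integrable lborel g"
  shows "fourier (\<lambda>x. f x + g x) \<omega> = fourier f \<omega> + fourier g \<omega>"
  unfolding fourier_def of_real_add distrib_right
  by (rule Bochner_Integration.integral_add; rule integrable_fourier; fact)

lemma fourier_diff:
  assumes "integrable lborel f" "integrable lborel g"
  shows "fourier (\<lambda>x. f x - g x) \<omega> = fourier f \<omega> - fourier g \<omega>"
  using fourier_add[OF assms(1), of "\<lambda>x. - 1 * g x" \<omega>] fourier_cmult[of "-1" g \<omega>] assms(2) by simp

lemma fourier_translate: "fourier (\<lambda>x. f (x - c)) \<omega> = wave \<omega> c * fourier f \<omega>"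
proof -
  have "wave \<omega> x = wave \<omega> c * wave \<omega> (x - c)" for x
    by (simp add: exp_add[symmetric] algebra_simps)
  then have "fourier (\<lambda>x. f (x - c)) \<omega>
      = integral\<^sup>L lborel (\<lambda>x. wave \<omega> c * (complex_of_real (f (x - c)) * wave \<omega> (x - c)))"
    unfolding fourier_def by (metis (no_types, lifting) mult.left_commute)
  also have "\<dots> = integral\<^sup>L lborel (\<lambda>x. wave \<omega> c * (complex_of_real (f x) * wave \<omega> x))"
    by (rule lebesgue_integral_translate[where f = "\<lambda>x. wave \<omega> c * (complex_of_real (f x) * wave \<omega> x)"])
  also have "\<dots> = wave \<omega> c * fourier f \<omega>"
    unfolding fourier_def by (rule integral_mult_right_zero)
  finally show ?thesis .
qed

text \<open>The Fourier transform turns the operator \<^const>\<open>comb\<close> into multiplication by the coefficient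
  polynomial, evaluated on the unit circle.\<close>

definition symbol :: "real poly \<Rightarrow> complex \<Rightarrow> complex" where
  "symbol P z = poly (map_poly complex_of_real P) z"

lemma symbol_0 [simp]: "symbol 0 z = 0"
  by (simp add: symbol_def)

lemma symbol_pCons [simp]: "symbol (pCons a P) z = complex_of_real a + z * symbol P z"
  by (simp add: symbol_def map_poly_pCons)

lemma symbol_add: "symbol (P + Q) z = symbol P z + symbol Q z"
proof (induction P arbitrary: Q)
  case (pCons a P)
  show ?case by (cases Q) (simp add: pCons.IH distrib_left)
qed simp

lemma symbol_smult: "symbol (smult c P) z = complex_of_real c * symbol P z"
  by (induction P) (auto simp: algebra_simps)

lemma symbol_mult: "symbol (P * Q) z = symbol P z * symbol Q z"
  by (induction P) (auto simp: symbol_add symbol_smult algebra_simps)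

lemma symbol_power: "symbol (P ^ k) z = symbol P z ^ k"
  by (induction k) (auto simp: symbol_mult one_pCons)

lemma fourier_comb:
  assumes "integrable lborel f"
  shows "fourier (comb P s f) \<omega> = symbol P (wave \<omega> s) * fourier f \<omega>"
proof (induction P)
  case 0
  show ?case by (simp add: fourier_def comb_def)
next
  case (pCons a P)
  have "comb (pCons a P) s f = (\<lambda>x. a * f x + comb P s f (x - s))"
    by (rule ext) simp
  then have "fourier (comb (pCons a P) s f) \<omega>
      = fourier (\<lambda>x. a * f x + comb P s f (x - s)) \<omega>" by (simp only:)
  also have "\<dots> = fourier (\<lambda>x. a * f x) \<omega> + fourier (\<lambda>x. comb P s f (x - s)) \<omega>"
    using assms by (intro fourier_add integrable_translate integrable_comb) simp_all
  also have "\<dots> = complex_of_real a * fourier f \<omega> + wave \<omega> s * fourier (comb P s f) \<omega>"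
    by (simp only: fourier_cmult fourier_translate[of "comb P s f"])
  also have "\<dots> = symbol (pCons a P) (wave \<omega> s) * fourier f \<omega>"
    unfolding pCons.IH symbol_pCons by (simp only: distrib_right mult.assoc)
  finally show ?case .
qed

text \<open>A probability density concentrated on \<open>{0..L}\<close> has Fourier transform close to \<open>1\<close>, since
  \<open>|exp (- i t) - 1| \<le> |t|\<close>. This makes the infinite products converge.\<close>

lemma fourier_bump_near_1:
  assumes "bump_on L f" "integral\<^sup>L lborel f = 1"
  shows "cmod (fourier f \<omega> - 1) \<le> \<bar>\<omega>\<bar> * L"
proof -
  have int: "integrable lborel f" by (rule bump_on_integrable) fact
  have "fourier f \<omega> - 1 = fourier f \<omega> - integral\<^sup>L lborel (\<lambda>x. complex_of_real (f x))"
    using assms(2) by simp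
  also have "\<dots> = integral\<^sup>L lborel (\<lambda>x. complex_of_real (f x) * wave \<omega> x - complex_of_real (f x))"
    unfolding fourier_def
    by (rule Bochner_Integration.integral_diff[symmetric])
       (use int integrable_fourier in \<open>auto simp del: mult_minus_left\<close>)
  also have "cmod \<dots> \<le> integral\<^sup>L lborel (\<lambda>x. f x * (\<bar>\<omega>\<bar> * L))"
  proof (rule Bochner_Integration.integral_norm_bound_integral)
    show "integrable lborel (\<lambda>x. complex_of_real (f x) * wave \<omega> x - complex_of_real (f x))"
      using int integrable_fourier by (auto simp del: mult_minus_left)
    show "integrable lborel (\<lambda>x. f x * (\<bar>\<omega>\<bar> * L))" using int by simp
    fix x :: real
    have nonneg: "f x \<ge> 0" by (rule bump_on_nonneg) fact
    show "cmod (complex_of_real (f x) * wave \<omega> x - complex_of_real (f x)) \<le> f x * (\<bar>\<omega>\<bar> * L)"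
    proof (cases "f x = 0")
      case False
      then have "0 < x \<and> x < L" using assms(1) unfolding bump_on_def by (meson not_le)
      then have "\<bar>\<omega> * x\<bar> \<le> \<bar>\<omega>\<bar> * L" by (simp add: abs_mult mult_left_mono)
      moreover have "cmod (wave \<omega> x - 1) \<le> \<bar>\<omega> * x\<bar>"
        using iexp_approx1[of "- \<omega> * x" 0] by (simp add: wave_eq_iexp)
      ultimately have "f x * cmod (wave \<omega> x - 1) \<le> f x * (\<bar>\<omega>\<bar> * L)"
        by (intro mult_left_mono nonneg) linarith
      moreover have "complex_of_real (f x) * wave \<omega> x - complex_of_real (f x)
          = complex_of_real (f x) * (wave \<omega> x - 1)"
        by (simp only: right_diff_distrib mult_1_right)
      then have "cmod (complex_of_real (f x) * wave \<omega> x - complex_of_real (f x))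
          = f x * cmod (wave \<omega> x - 1)"
        using nonneg by (simp only: norm_mult norm_of_real abs_of_nonneg)
      ultimately show ?thesis by simp
    qed simp
  qed
  also have "\<dots> = \<bar>\<omega>\<bar> * L" using assms(2) by simp
  finally show ?thesis .
qed

lemma AE_zero_imp_zero:
  fixes f :: "real \<Rightarrow> real"
  assumes cont: "continuous_on UNIV f" and zero: "\<And>x. x \<notin> {a..b} \<Longrightarrow> f x = 0" and ae: "AE x in lborel. f x = 0"
  shows "f x = 0"
proof (cases "x \<in> {a..b}")
  case True
  \<comment> \<open>Enlarging the interval makes it nondegenerate, as the criterion for a vanishing integral requires.\<close>
  have "integral {a - 1..b + 1} (\<lambda>x. \<bar>f x\<bar>) = integral\<^sup>L lborel (\<lambda>x. \<bar>f x\<bar>)"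
    by (rule lebesgue_integral_compactly_supported[symmetric])
       (use zero in \<open>auto intro!: continuous_intros cont\<close>)
  also have "\<dots> = 0" by (rule integral_eq_zero_AE) (use ae in auto)
  finally have "integral {a - 1..b + 1} (\<lambda>x. \<bar>f x\<bar>) = 0" .
  moreover have "continuous_on {a - 1..b + 1} (\<lambda>x. \<bar>f x\<bar>)"
    by (intro continuous_intros continuous_on_subset[OF cont]) auto
  ultimately have "\<forall>x\<in>{a - 1..b + 1}. \<bar>f x\<bar> = 0"
    using True by (subst integral_eq_0_iff[symmetric]) auto
  then show ?thesis using True by simp
qed (rule zero)

text \<open>Up to the sign of the frequency, the Fourier transform of a probability density is its characteristic
  function, so Levy's uniqueness theorem applies.\<close>

lemma density_unique_by_fourier:
  assumes int: "integrable lborel p" "integrable lborel r"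
    and nonneg: "\<And>x. p x \<ge> 0" "\<And>x. r x \<ge> 0"
    and mass: "integral\<^sup>L lborel p = 1" "integral\<^sup>L lborel r = 1"
    and eq: "\<And>\<omega>. fourier p \<omega> = fourier r \<omega>"
  shows "AE x in lborel. p x = r x"
proof -
  have dist: "real_distribution (density lborel (\<lambda>x. ennreal (g x)))"
    if "integrable lborel g" "\<And>x. g x \<ge> 0" "integral\<^sup>L lborel g = 1" for g :: "real \<Rightarrow> real"
  proof -
    have [measurable]: "g \<in> borel_measurable borel"
      using borel_measurable_integrable[OF that(1)] by simp
    have "emeasure (density lborel (\<lambda>x. ennreal (g x))) UNIV = (\<integral>\<^sup>+ x. ennreal (g x) \<partial>lborel)"
      by (subst emeasure_density) auto
    also have "\<dots> = 1" using that by (simp add: nn_integral_eq_integral)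
    finally have "prob_space (density lborel (\<lambda>x. ennreal (g x)))"
      by (intro prob_spaceI) simp
    then show ?thesis by (simp add: real_distribution_def real_distribution_axioms_def)
  qed
  have char: "char (density lborel (\<lambda>x. ennreal (g x))) t = fourier g (- t)"
    if "integrable lborel g" "\<And>x. g x \<ge> 0" for g t
  proof -
    have "g \<in> borel_measurable lborel"
      using borel_measurable_integrable[OF that(1)] by simp
    then have "char (density lborel (\<lambda>x. ennreal (g x))) t = integral\<^sup>L lborel (\<lambda>x. g x *\<^sub>R iexp (t * x))"
      unfolding char_def using that(2)
      by (intro integral_density) (auto intro!: borel_measurable_continuous_onI continuous_intros)
    also have "\<dots> = fourier g (- t)"
      by (simp add: fourier_def scaleR_conv_of_real)
    finally show ?thesis .
  qed
  have "density lborel (\<lambda>x. ennreal (p x)) = density lborel (\<lambda>x. ennreal (r x))"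
    by (rule Levy_uniqueness)
       (use dist[OF int(1) nonneg(1) mass(1)] dist[OF int(2) nonneg(2) mass(2)] in
         \<open>simp_all add: fun_eq_iff char int nonneg eq\<close>)
  then have "AE x in lborel. ennreal (p x) = ennreal (r x)"
    using borel_measurable_integrable[OF int(1)] borel_measurable_integrable[OF int(2)]
    by (subst (asm) sigma_finite_measure.density_unique_iff[OF sigma_finite_lborel]) auto
  then show ?thesis using nonneg by simp
qed

text \<open>Write \<open>f\<close> as the difference of two nonnegative functions with equal Fourier transforms, hence with
  equal integrals. Adding the same hat function to both makes this common integral positive,
  and the two can be normalized to probability densities.\<close>

lemma fourier_zero_imp_zero:
  assumes cont: "continuous_on UNIV f" and zero: "\<And>x. x \<notin> {a..b} \<Longrightarrow> f x = 0"
    and fz: "\<And>\<omega>. fourier f \<omega> = 0"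
  shows "f x = 0"
proof -
  have bump: "bump_on (2 * 1) (hat 1)" by (rule bump_on_hat) simp
  have int_hat: "integrable lborel (hat 1)" by (rule bump_on_integrable[OF bump])
  define p r where "p x = max (f x) 0 + hat 1 x" and "r x = max (- f x) 0 + hat 1 x" for x
  have int_max: "integrable lborel (\<lambda>x. max (f x) 0)" "integrable lborel (\<lambda>x. max (- f x) 0)"
    by (rule integrable_compactly_supported[of _ a b]; use zero in \<open>force intro!: continuous_intros cont\<close>)+
  have int: "integrable lborel p" "integrable lborel r"
    unfolding p_def r_def using int_max int_hat by simp_all
  have nonneg: "p x \<ge> 0" "r x \<ge> 0" for x
    using bump_on_nonneg[OF bump, of x] by (simp_all add: p_def r_def)
  have f: "f = (\<lambda>x. p x - r x)" by (auto simp: p_def r_def max_def)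
  have eq: "fourier p \<omega> = fourier r \<omega>" for \<omega>
    using fz[of \<omega>] fourier_diff[OF int] by (simp add: f[symmetric])
  define c where "c = integral\<^sup>L lborel p"
  have "integral\<^sup>L lborel (hat 1) \<le> c"
    unfolding c_def by (rule integral_mono[OF int_hat int(1)]) (simp add: p_def)
  then have c: "c \<ge> 1" by (simp add: integral_hat)
  have "fourier g 0 = complex_of_real (integral\<^sup>L lborel g)" for g
    by (simp add: fourier_def)
  then have c': "integral\<^sup>L lborel r = c" using eq[of 0] by (simp add: c_def)
  have "AE x in lborel. 1 / c * p x = 1 / c * r x"
  proof (rule density_unique_by_fourier)
    show "fourier (\<lambda>x. 1 / c * p x) \<omega> = fourier (\<lambda>x. 1 / c * r x) \<omega>" for \<omega>
      unfolding fourier_cmult eq ..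
    show "integral\<^sup>L lborel (\<lambda>x. 1 / c * p x) = 1" "integral\<^sup>L lborel (\<lambda>x. 1 / c * r x) = 1"
      using c c' by (simp_all flip: c_def)
  qed (use int nonneg c in simp_all)
  then have "AE x in lborel. f x = 0" using c by (simp add: f)
  then show ?thesis using AE_zero_imp_zero[OF cont zero] by blast
qed

lemma fourier_inj:
  assumes "continuous_on UNIV f" "compact (supp f)" "continuous_on UNIV g" "compact (supp g)"
    and "\<And>\<omega>. fourier f \<omega> = fourier g \<omega>"
  shows "f = g"
proof -
  have "bounded (supp f \<union> supp g)" using assms by (simp add: compact_imp_bounded)
  then obtain B where B: "\<And>x. x \<in> supp f \<union> supp g \<Longrightarrow> norm x \<le> B"
    by (auto simp: bounded_iff)
  have zero: "f x = 0" "g x = 0" if "x \<notin> {-B..B}" for x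
  proof -
    have "x \<notin> supp f \<union> supp g" using B[of x] that by auto
    then show "f x = 0" "g x = 0"
      using subsetD[OF closure_subset, of x "{x. f x \<noteq> 0}"] subsetD[OF closure_subset, of x "{x. g x \<noteq> 0}"]
      by (auto simp: supp_def)
  qed
  have "f x - g x = 0" for x
  proof (rule fourier_zero_imp_zero[where f = "\<lambda>x. f x - g x" and a = "-B" and b = B])
    show "continuous_on UNIV (\<lambda>x. f x - g x)" using assms by (intro continuous_intros)
    show "fourier (\<lambda>x. f x - g x) \<omega> = 0" for \<omega>
      by (subst fourier_diff)
         (auto intro!: integrable_compactly_supported[of _ "-B" B] zero assms simp: assms(5))
  qed (simp add: zero)
  then show ?thesis by auto
qed

text \<open>The infinite product telescopes. Its factors may vanish at finitely many indices; convergence in the strict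
  sense follows because \<open>a k - 1 = (F k - F (Suc k)) / F (Suc k)\<close> is summable once \<open>F (Suc k)\<close> is bounded away
  from \<open>0\<close>.\<close>

lemma prodinf_by_refinement:
  fixes a F :: "nat \<Rightarrow> complex"
  assumes step: "\<And>k. F k = a k * F (Suc k)" and near: "\<And>k. cmod (F k - 1) \<le> C * (1 / 2) ^ k"
  shows "prodinf a = F 0"
proof -
  have lim0: "(\<lambda>k. C * (1 / 2 :: real) ^ k) \<longlonglongrightarrow> 0"
    using tendsto_mult_left[OF LIMSEQ_power_zero[of "1 / 2 :: real"], of C] by simp
  have "(\<lambda>k. F k - 1) \<longlonglongrightarrow> 0"
    by (rule Lim_null_comparison[OF _ lim0]) (simp add: near)
  then have lim1: "F \<longlonglongrightarrow> 1" by (simp add: LIM_zero_iff)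
  have C: "C \<ge> 0" using order_trans[OF norm_ge_zero near[of 0]] by simp
  have "\<forall>\<^sub>F k in sequentially. C * (1 / 2) ^ k < 1 / 2"
    by (rule order_tendstoD(2)[OF lim0]) simp
  then have "\<forall>\<^sub>F k in sequentially. norm (norm (a k - 1)) \<le> 4 * C * (1 / 2) ^ k"
  proof eventually_elim
    case (elim k)
    have half: "C * (1 / 2) ^ Suc k \<le> C * (1 / 2) ^ k" using C by simp
    have "cmod 1 \<le> cmod (F (Suc k)) + cmod (F (Suc k) - 1)"
      using norm_triangle_ineq4[of "F (Suc k)" "F (Suc k) - 1"] by simp
    then have F: "cmod (F (Suc k)) \<ge> 1 / 2" using near[of "Suc k"] half elim by simp
    have "cmod (a k - 1) * cmod (F (Suc k)) = cmod ((F k - 1) - (F (Suc k) - 1))"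
      by (simp add: norm_mult[symmetric] step[of k] left_diff_distrib)
    also have "\<dots> \<le> cmod (F k - 1) + cmod (F (Suc k) - 1)" by (rule norm_triangle_ineq4)
    also have "\<dots> \<le> 2 * C * (1 / 2) ^ k" using near[of k] near[of "Suc k"] half by linarith
    finally have "cmod (a k - 1) * cmod (F (Suc k)) \<le> 2 * C * (1 / 2) ^ k" .
    moreover have "cmod (a k - 1) * (1 / 2) \<le> cmod (a k - 1) * cmod (F (Suc k))"
      by (rule mult_left_mono[OF F]) simp
    ultimately show ?case by simp
  qed
  then have "summable (\<lambda>k. norm (a k - 1))"
    by (rule summable_comparison_test_ev) (intro summable_mult summable_geometric, simp)
  then have conv: "convergent_prod a"
    by (intro abs_convergent_prod_imp_convergent_prod summable_imp_abs_convergent_prod)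
  have partial: "F 0 = (\<Prod>i\<le>n. a i) * F (Suc n)" for n
  proof (induction n)
    case 0
    show ?case using step[of 0] by simp
  next
    case (Suc n)
    then show ?case by (simp add: step[of "Suc n"] mult.assoc)
  qed
  have "(\<lambda>n. (\<Prod>i\<le>n. a i) * F (Suc n)) \<longlonglongrightarrow> prodinf a * 1"
    by (intro tendsto_mult convergent_prod_LIMSEQ conv LIMSEQ_Suc lim1)
  then have "(\<lambda>n. F 0) \<longlonglongrightarrow> prodinf a" by (simp flip: partial)
  then show ?thesis by (simp only: LIMSEQ_const_iff)
qed

section \<open>The symbols of the masks and the refinable functions\<close>

lemma mask_symbol_0:
  assumes "n \<ge> 1"
  shows "mask_symbol \<mu> n 0 z = symbol [:1/2, 1/2:] z"
proof -
  obtain k where n: "n = Suc k" using assms by (cases n) auto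
  have "mask_symbol \<mu> n 0 z = (\<Sum>\<alpha>\<le>Suc (Suc k). complex_of_real (mask \<mu> n 0 \<alpha>) * z ^ \<alpha>)"
    by (simp add: mask_symbol_def n)
  also have "\<dots> = symbol [:1/2, 1/2:] z"
    unfolding sum.atMost_Suc_shift by (simp add: mask_def)
  finally show ?thesis .
qed

text \<open>The bracket in the definition of the mask has generating function
  \<open>(1 + z)^(N + 2) + 4 (2 powr e - 1) z (1 + z)^N\<close>, from which \<open>(1 + z)^N\<close> splits off.\<close>

lemma mask_symbol_pos:
  assumes "m > 0"
  shows "mask_symbol \<mu> (Suc N) m z
    = symbol ([:1/2, 1/2:] ^ N * quad_mask (real m powr (- \<mu>))) z"
proof -
  define e where "e = real m powr (- \<mu>)"
  define p where "p = complex_of_real (2 powr (- e))"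
  define c where "c = complex_of_real (1 / 2 powr (real (Suc N) + 1 + e))"
  define t where "t = (1 / 2 ^ (N + 2) :: complex)"
  define b where "b = complex_of_real (4 * (2 powr e - 1))"
  have "2 powr (real (Suc N) + 1 + e) = 2 ^ (N + 2) * 2 powr e"
  proof -
    have "real (Suc N) + 1 + e = real (N + 2) + e" by simp
    then show ?thesis using powr_realpow[of 2 "N + 2"] by (simp only: powr_add)
  qed
  then have c: "c = p * t"
    by (simp add: c_def p_def t_def powr_minus_divide)
  have "2 powr e * 2 powr (- e) = (1 :: real)" by (simp add: powr_add[symmetric])
  then have pb: "p * b = 4 * (1 - p)"
    unfolding p_def b_def of_real_mult[symmetric] by (simp add: algebra_simps)
  have bin: "(\<Sum>k\<le>M. of_nat (M choose k) * z ^ k) = (1 + z) ^ M" for M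
    using binomial_ring[of z 1 M] by (simp add: add.commute)
  have scale: "(1 + z) ^ N * t * (4 * X) = ((1 + z) / 2) ^ N * X" for X
    by (simp add: t_def power_divide)
  have "mask_symbol \<mu> (Suc N) m z = (\<Sum>\<alpha>\<le>N + 2. c * (of_nat ((N + 2) choose \<alpha>) +
      b * (if \<alpha> = 0 then 0 else of_nat (N choose (\<alpha> - 1)))) * z ^ \<alpha>)"
    unfolding mask_symbol_def
    by (rule sum.cong) (use assms in \<open>auto simp: mask_def c_def b_def e_def\<close>)
  also have "\<dots> = c * ((\<Sum>\<alpha>\<le>N + 2. of_nat ((N + 2) choose \<alpha>) * z ^ \<alpha>) +
      b * (\<Sum>\<alpha>\<le>N + 2. (if \<alpha> = 0 then 0 else of_nat (N choose (\<alpha> - 1))) * z ^ \<alpha>))"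
    unfolding sum_distrib_left sum.distrib[symmetric]
    by (rule sum.cong) (simp_all only: ring_distribs mult.assoc)
  also have "(\<Sum>\<alpha>\<le>N + 2. (if \<alpha> = 0 then 0 else of_nat (N choose (\<alpha> - 1))) * z ^ \<alpha>)
      = (\<Sum>\<beta>\<le>Suc N. of_nat (N choose \<beta>) * z ^ Suc \<beta>)"
    unfolding add_2_eq_Suc' by (subst sum.atMost_Suc_shift) simp
  also have "\<dots> = z * (\<Sum>\<beta>\<le>N. of_nat (N choose \<beta>) * z ^ \<beta>)"
    by (simp add: sum_distrib_left mult.left_commute)
  also have "c * ((\<Sum>\<alpha>\<le>N + 2. of_nat ((N + 2) choose \<alpha>) * z ^ \<alpha>)
        + b * (z * (\<Sum>\<beta>\<le>N. of_nat (N choose \<beta>) * z ^ \<beta>)))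
      = (1 + z) ^ N * t * (p * (1 + z)\<^sup>2 + (p * b) * z)"
    unfolding bin c power_add by (simp only: ring_distribs mult_ac)
  also have "p * (1 + z)\<^sup>2 + (p * b) * z = 4 * (p / 4 + (1 - p / 2) * z + p / 4 * z\<^sup>2)"
    unfolding pb by (simp add: power2_eq_square algebra_simps)
  also have "(1 + z) ^ N * t * (4 * (p / 4 + (1 - p / 2) * z + p / 4 * z\<^sup>2))
      = ((1 + z) / 2) ^ N * (p / 4 + (1 - p / 2) * z + p / 4 * z\<^sup>2)"
    by (rule scale)
  also have "p / 4 + (1 - p / 2) * z + p / 4 * z\<^sup>2 = symbol (quad_mask e) z"
    by (simp add: quad_mask_def p_def power2_eq_square distrib_left mult_ac)
  also have "(1 + z) / 2 = symbol [:1/2, 1/2:] z" by (simp add: add_divide_distrib)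
  also have "symbol [:1/2, 1/2:] z ^ N * symbol (quad_mask e) z
      = symbol ([:1/2, 1/2:] ^ N * quad_mask e) z"
    by (simp only: symbol_mult symbol_power)
  finally show ?thesis by (simp only: e_def)
qed

theorem theorem4p6:
  fixes \<mu> :: real and n m :: nat
  assumes "\<mu> > 1" and "n > 2"
  shows "bell_shaped (refinable_function \<mu> n m)"
proof -
  define \<epsilon> where "\<epsilon> k = real k powr (- \<mu>)" for k
  interpret perturbed_cascade \<epsilon>
  proof
    show "\<epsilon> k \<ge> 0" for k by (simp add: \<epsilon>_def)
    show "summable \<epsilon>" unfolding \<epsilon>_def using assms(1) by (subst summable_real_powr_iff) simp
  qed
  define l where "l k = max 1 k" for k :: nat
  \<comment> \<open>Level \<open>0\<close> needs the window \<open>1 = 2 * mesh 1\<close> on the functions of level \<open>1\<close>, hence \<^term>\<open>l k\<close>.\<close>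
  define \<psi> where "\<psi> k = coarsen (mesh k) (smooth (n - 2) (l k))" for k
  define L where "L k = real n * mesh (l k) + mesh k" for k
  have n: "Suc (n - 2) = n - 1" "Suc (n - 1) = n" "n - 2 + 2 = n" using assms(2) by auto
  have bump': "bump_on (real n * mesh (l k)) (smooth (n - 2) (l k))" for k
    using bump_on_smooth[of "n - 2" "l k"] by (simp only: n)
  have npos: "real n * mesh (l k) > 0" for k using assms(2) by simp
  have bump: "bump_on (L k) (\<psi> k)" for k
    unfolding \<psi>_def L_def by (rule bump_on_coarsen[OF bump' _ npos]) simp
  have mass: "integral\<^sup>L lborel (\<psi> k) = 1" for k
    unfolding \<psi>_def using bump_on_lebesgue_integral_coarsen[OF bump' _ npos] integral_smooth by simp
  have L: "L k \<le> (real n + 1) * mesh k" for k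
    unfolding L_def l_def by (cases k) (auto simp: field_simps)
  have \<psi>_pos: "\<psi> k = smooth (n - 1) k" if "k > 0" for k
  proof -
    have "l k = k" using that by (simp add: l_def)
    then show ?thesis unfolding \<psi>_def n(1)[symmetric] smooth.simps by (simp only:)
  qed
  have \<psi>_refine: "fourier (\<psi> k) \<omega>
      = mask_symbol \<mu> n k (wave \<omega> (mesh (Suc k))) * fourier (\<psi> (Suc k)) \<omega>" for k \<omega>
  proof -
    have int: "integrable lborel (\<psi> (Suc k))" by (rule bump_on_integrable[OF bump])
    have \<psi>_Suc: "\<psi> (Suc k) = smooth (n - 1) (Suc k)" by (rule \<psi>_pos) simp
    show ?thesis
    proof (cases "k = 0")
      case True
      have "\<psi> 0 = coarsen (2 * mesh 1) (smooth (n - 2) 1)" by (simp add: \<psi>_def l_def)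
      also have "\<dots> = comb [:1/2, 1/2:] (mesh 1) (coarsen (mesh 1) (smooth (n - 2) 1))"
        by (rule coarsen_double[OF continuous_on_smooth]) simp
      also have "coarsen (mesh 1) (smooth (n - 2) 1) = \<psi> 1" by (simp add: \<psi>_def l_def)
      finally have "\<psi> k = comb [:1/2, 1/2:] (mesh (Suc k)) (\<psi> (Suc k))"
        unfolding True One_nat_def .
      moreover have "mask_symbol \<mu> n k z = symbol [:1/2, 1/2:] z" for z
        unfolding True by (rule mask_symbol_0) (use assms(2) in simp)
      ultimately show ?thesis
        using fourier_comb[OF int] by (simp only:)
    next
      case False
      then have "\<psi> k = comb (smooth_mask (n - 1) k) (mesh (Suc k)) (\<psi> (Suc k))"
        unfolding \<psi>_Suc using \<psi>_pos[of k] smooth_refinement[of "n - 1" k] by simp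
      moreover have "symbol (smooth_mask (n - 1) k) z = mask_symbol \<mu> n k z" for z
        using mask_symbol_pos[of k \<mu> "n - 1" z] False unfolding n by (simp add: smooth_mask_def \<epsilon>_def)
      ultimately show ?thesis
        using fourier_comb[OF int] by (simp only:)
    qed
  qed
  have refinable: "is_refinable_function \<mu> n m (\<psi> m)"
  proof -
    have cont: "continuous_on UNIV (\<psi> m)" using bump by (simp add: bump_on_def)
    have "integrable lborel (\<lambda>x. (\<psi> m x)\<^sup>2)"
      by (rule integrable_compactly_supported[of _ 0 "L m"])
         (use bump[of m] in \<open>auto simp: bump_on_def intro!: continuous_intros\<close>)
    moreover have "compact (supp (\<psi> m))"
    proof -
      have "L m > 0" unfolding L_def using npos[of m] by (intro add_pos_pos) simp_all
      then show ?thesis using bump_on_supp(1)[OF bump[of m]] by simp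
    qed
    moreover have "prodinf (\<lambda>k. mask_symbol \<mu> n (m + k) (wave \<omega> (mesh (Suc (m + k))))) = fourier (\<psi> m) \<omega>" for \<omega>
    proof -
      have near: "cmod (fourier (\<psi> (m + k)) \<omega> - 1) \<le> \<bar>\<omega>\<bar> * (real n + 1) * (1 / 2) ^ k" for k
      proof -
        have "cmod (fourier (\<psi> (m + k)) \<omega> - 1) \<le> \<bar>\<omega>\<bar> * L (m + k)"
          by (rule fourier_bump_near_1[OF bump mass])
        also have "\<dots> \<le> \<bar>\<omega>\<bar> * ((real n + 1) * mesh (m + k))"
          by (intro mult_left_mono L) simp
        also have "\<dots> \<le> \<bar>\<omega>\<bar> * ((real n + 1) * (1 / 2) ^ k)"
          by (intro mult_left_mono) (auto simp: power_add field_simps)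
        finally show ?thesis by (simp only: mult.assoc)
      qed
      have step: "fourier (\<psi> (m + k)) \<omega>
          = mask_symbol \<mu> n (m + k) (wave \<omega> (mesh (Suc (m + k)))) * fourier (\<psi> (m + Suc k)) \<omega>" for k
        unfolding add_Suc_right by (rule \<psi>_refine)
      show ?thesis
        using prodinf_by_refinement[where F = "\<lambda>k. fourier (\<psi> (m + k)) \<omega>", OF step near]
        by (simp only: add_0_right)
    qed
    ultimately show ?thesis
      unfolding is_refinable_function_def using cont by simp
  qed
  have "refinable_function \<mu> n m = \<psi> m"
    unfolding refinable_function_def
  proof (rule the_equality)
    show "is_refinable_function \<mu> n m (\<psi> m)" by (rule refinable)
    fix f assume "is_refinable_function \<mu> n m f"
    then show "f = \<psi> m"
      using refinable unfolding is_refinable_function_def by (intro fourier_inj) auto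
  qed
  moreover have "bell_shaped (coarsen (mesh m) (smooth (Suc (n - 3)) (l m)))"
    by (rule bell_shaped_coarsen_smooth) (cases m; simp add: l_def)
  moreover have "Suc (n - 3) = n - 2" using assms(2) by simp
  ultimately show ?thesis by (simp add: \<psi>_def)
qed

end
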